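(* Let $\mathbb{G}=(G_1,G_0)$ be a group-groupoid, let $\mathcal{A}(\mathbb{G})=(\mathcal{W}(\mathbb{G}),\operatorname{Aut}(\mathbb{G}))$ be its actor group-groupoid with source and target maps $\widetilde{d_0},\widetilde{d_1}$, and let $(A,B,\alpha)$ be the crossed module corresponding to $\mathbb{G}$, that is $A=\operatorname{Ker} d_0$, $B=G_0$, $\alpha=d_1|_A$, with action $x\cdot a=1_x+a-1_x$. Define $$\xi\colon \operatorname{Ker}\widetilde{d_0}\to \mathrm{D}(B,A),\quad \xi(\eta)=d_\eta,\quad d_\eta(x)=\eta(x)-1_x\ (x\in B),$$ $$\lambda\colon \operatorname{Aut}(\mathbb{G})\to\operatorname{Aut}(A,B,\alpha),\quad \lambda(f)=\langle f_1|_A,f_0\rangle .$$ Then $$\langle\xi,\lambda\rangle\colon\bigl(\operatorname{Ker}\widetilde{d_0},\operatorname{Aut}(\mathbb{G}),\widetilde{d_1}|_{\operatorname{Ker}\widetilde{d_0}}\bigr)\to\bigl(\mathrm{D}(B,A),\operatorname{Aut}(A,B,\alpha),\Delta\bigr)$$ is an isomorphism of crossed modules, where the first crossed module is the one corresponding to the group-groupoid $\mathcal{A}(\mathbb{G})$ and the second is the actor crossed module of $(A,B,\alpha)$.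
   Context: A group-groupoid $\mathbb{G}=(G_1,G_0)$ is an internal category (groupoid) in the category of groups: a groupoid with set of morphisms $G_1$ and set of objects $G_0$, both equipped with (not necessarily abelian, additively written) group structures, such that the source map $d_0\colon G_1\to G_0$, the target map $d_1\colon G_1\to G_0$, the identity map $\varepsilon\colon G_0\to G_1$, $\varepsilon(x)=1_x$, and the composition $m(b,a)=b\circ a$ (defined on the pullback of pairs with $d_0(b)=d_1(a)$) are group homomorphisms. A morphism of group-groupoids is a functor $f=(f_1,f_0)$ with $f_1,f_0$ group homomorphisms; $\operatorname{Aut}(\mathbb{G})$ is the group of automorphisms of $\mathbb{G}$. $\operatorname{Nat}(\mathbb{G})$ is the set of natural transformations $\eta\colon f\Rightarrow g$ between group-groupoid morphisms $f,g\colon\mathbb{G}\to\mathbb{G}$ (source and target being part of the data): families $\eta(x)\colon f(x)\to g(x)$, $x\in G_0$, with $\eta(y)\circ f(a)=g(a)\circ\eta(x)$ for every $a\colon x\to y$, and $\eta(x_1+x_2)=\eta(x_1)+\eta(x_2)$. It is a monoid under horizontal composition: for $\eta\colon f\Rightarrow g$, $\eta'\colon f'\Rightarrow g'$, $\eta'\circ_h\eta\colon f'f\Rightarrow g'g$ is $(\eta'\circ_h\eta)(x)=\eta'(g(x))\circ f'(\eta(x))$. $\mathcal{W}(\mathbb{G})$ is the group of its invertible (regular) elements. The actor group-groupoid $\mathcal{A}(\mathbb{G})$ has group of morphisms $\mathcal{W}(\mathbb{G})$ (under $\circ_h$), group of objects $\operatorname{Aut}(\mathbb{G})$, $\widetilde{d_0}(\eta)=f$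 and $\widetilde{d_1}(\eta)=g$ for $\eta\colon f\Rightarrow g$, $\widetilde{\varepsilon}(f)=1_f$, and composition given by vertical composition $(\zeta\circ_v\eta)(x)=\zeta(x)\circ\eta(x)$. A crossed module $(A,B,\alpha)$ is a group homomorphism $\alpha\colon A\to B$ with a left action of $B$ on $A$ (by automorphisms) such that $\alpha(b\cdot a)=b+\alpha(a)-b$ and $\alpha(a)\cdot a_1=a+a_1-a$. A morphism $\langle f_A,f_B\rangle\colon(A,B,\alpha)\to(A',B',\alpha')$ is a pair of group homomorphisms with $f_B\alpha=\alpha'f_A$ and $f_A(b\cdot a)=f_B(b)\cdot f_A(a)$. The crossed module corresponding to a group-groupoid $\mathbb{G}$ is $(\operatorname{Ker}d_0,G_0,d_1|_{\operatorname{Ker} d_0})$ with action $x\cdot a=1_x+a-1_x$; in particular for $\mathcal{A}(\mathbb{G})$ the action of $\operatorname{Aut}(\mathbb{G})$ on $\operatorname{Ker}\widetilde{d_0}$ is $f\cdot\eta=1_f\circ_h\eta\circ_h1_{f^{-1}}$. A derivation of $(A,B,\alpha)$ is a map $d\colon B\to A$ with $d(b+b_1)=d(b)+b\cdot d(b_1)$. It defines endomorphisms $\theta_d(a)=d\alpha(a)+a$ of $A$ and $\sigma_d(b)=\alpha d(b)+b$ of $B$. Derivations form a monoid under $(d\circ d')(b)=d(\sigma_{d'}(b))+d'(b)$, with the zero map as identity; $\mathrm{D}(B,A)$ is its group of units (regular derivations). The actor crossed module of $(A,B,\alpha)$ is $(\mathrm{D}(B,A),\operatorname{Aut}(A,B,\alpha),\Delta)$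 with $\Delta(d)=\langle\theta_d,\sigma_d\rangle$ and action $\langle f,g\rangle\cdot d=fdg^{-1}$. *)

theory Defs
  imports "HOL-Algebra.Coset"
begin

text \<open>
  All groups are HOL-Algebra groups, hence written multiplicatively: the sum \<open>a + b\<close> of the
  usual additive notation is \<open>a \<otimes> b\<close>, the negative \<open>- a\<close> is \<open>inv a\<close>.
  Maps that are elements of a set being formed (endomorphisms, transformations, derivations)
  are extensional, i.e. \<open>undefined\<close> off the carrier, so that equality in that set is
  equality of maps on the carrier.
\<close>

section \<open>Group-groupoids\<close>

record ('m, 'o) ggd =
  Mor :: "'m monoid"
  Obj :: "'o monoid"
  src :: "'m \<Rightarrow> 'o"
  tgt :: "'m \<Rightarrow> 'o"
  idn :: "'o \<Rightarrow> 'm"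
  cmp :: "'m \<Rightarrow> 'm \<Rightarrow> 'm"  \<comment> \<open>\<open>cmp b a\<close> is \<open>b \<circ> a\<close>; only relevant when \<open>src b = tgt a\<close>\<close>

definition composable :: "('m, 'o) ggd \<Rightarrow> ('m \<times> 'm) set" where
  "composable G =
     {(b, a). b \<in> carrier (Mor G) \<and> a \<in> carrier (Mor G) \<and> src G b = tgt G a}"

locale group_groupoid =
  fixes G :: "('m, 'o) ggd"
  assumes group_Mor: "group (Mor G)"
    and group_Obj: "group (Obj G)"
    and src_hom: "src G \<in> hom (Mor G) (Obj G)"
    and tgt_hom: "tgt G \<in> hom (Mor G) (Obj G)"
    and idn_hom: "idn G \<in> hom (Obj G) (Mor G)"
    and cmp_hom: "(\<lambda>(b, a). cmp G b a)
        \<in> hom ((Mor G \<times>\<times> Mor G)\<lparr>carrier := composable G\<rparr>) (Mor G)"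
    and src_idn: "x \<in> carrier (Obj G) \<Longrightarrow> src G (idn G x) = x"
    and tgt_idn: "x \<in> carrier (Obj G) \<Longrightarrow> tgt G (idn G x) = x"
    and src_cmp: "(b, a) \<in> composable G \<Longrightarrow> src G (cmp G b a) = src G a"
    and tgt_cmp: "(b, a) \<in> composable G \<Longrightarrow> tgt G (cmp G b a) = tgt G b"
    and cmp_assoc: "\<lbrakk>(c, b) \<in> composable G; (b, a) \<in> composable G\<rbrakk>
        \<Longrightarrow> cmp G (cmp G c b) a = cmp G c (cmp G b a)"
    and cmp_idn_right: "a \<in> carrier (Mor G) \<Longrightarrow> cmp G a (idn G (src G a)) = a"
    and cmp_idn_left: "a \<in> carrier (Mor G) \<Longrightarrow> cmp G (idn G (tgt G a)) a = a"
    and cmp_inverse: "a \<in> carrier (Mor G) \<Longrightarrow>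
        \<exists>b \<in> carrier (Mor G). src G b = tgt G a \<and> tgt G b = src G a \<and>
          cmp G b a = idn G (src G a) \<and> cmp G a b = idn G (tgt G a)"

definition ggd_hom :: "('m, 'o) ggd \<Rightarrow> ('n, 'p) ggd \<Rightarrow> (('m \<Rightarrow> 'n) \<times> ('o \<Rightarrow> 'p)) set" where
  "ggd_hom G H = {(f1, f0).
     f1 \<in> hom (Mor G) (Mor H) \<and> f0 \<in> hom (Obj G) (Obj H) \<and>
     (\<forall>a \<in> carrier (Mor G). src H (f1 a) = f0 (src G a) \<and> tgt H (f1 a) = f0 (tgt G a)) \<and>
     (\<forall>x \<in> carrier (Obj G). f1 (idn G x) = idn H (f0 x)) \<and>
     (\<forall>(b, a) \<in> composable G. f1 (cmp G b a) = cmp H (f1 b) (f1 a))}"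

type_synonym ('m, 'o) ggd_map = "('m \<Rightarrow> 'm) \<times> ('o \<Rightarrow> 'o)"

definition ggd_End :: "('m, 'o) ggd \<Rightarrow> ('m, 'o) ggd_map monoid" where
  "ggd_End G =
    \<lparr>carrier = ggd_hom G G \<inter>
       (extensional (carrier (Mor G)) \<times> extensional (carrier (Obj G))),
     mult = (\<lambda>(f1, f0) (g1, g0).
       (compose (carrier (Mor G)) f1 g1, compose (carrier (Obj G)) f0 g0)),
     one = (\<lambda>a \<in> carrier (Mor G). a, \<lambda>x \<in> carrier (Obj G). x)\<rparr>"

definition ggd_Aut :: "('m, 'o) ggd \<Rightarrow> ('m, 'o) ggd_map monoid" where
  "ggd_Aut G = units_of (ggd_End G)"

section \<open>Natural transformations and the actor group-groupoid\<close>

record ('m, 'o) ntrans =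
  nt_src :: "('m, 'o) ggd_map"
  nt_tgt :: "('m, 'o) ggd_map"
  nt_map :: "'o \<Rightarrow> 'm"

definition nat_trans :: "('m, 'o) ggd \<Rightarrow> ('m, 'o) ntrans set" where
  "nat_trans G = {\<eta>.
     nt_src \<eta> \<in> carrier (ggd_End G) \<and> nt_tgt \<eta> \<in> carrier (ggd_End G) \<and>
     nt_map \<eta> \<in> hom (Obj G) (Mor G) \<and> nt_map \<eta> \<in> extensional (carrier (Obj G)) \<and>
     (\<forall>x \<in> carrier (Obj G).
        src G (nt_map \<eta> x) = snd (nt_src \<eta>) x \<and> tgt G (nt_map \<eta> x) = snd (nt_tgt \<eta>) x) \<and>
     (\<forall>a \<in> carrier (Mor G).
        cmp G (nt_map \<eta> (tgt G a)) (fst (nt_src \<eta>) a) =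
        cmp G (fst (nt_tgt \<eta>) a) (nt_map \<eta> (src G a)))}"

definition nt_id :: "('m, 'o) ggd \<Rightarrow> ('m, 'o) ggd_map \<Rightarrow> ('m, 'o) ntrans" where
  "nt_id G f =
    \<lparr>nt_src = f, nt_tgt = f, nt_map = (\<lambda>x \<in> carrier (Obj G). idn G (snd f x))\<rparr>"

definition nt_hcomp ::
  "('m, 'o) ggd \<Rightarrow> ('m, 'o) ntrans \<Rightarrow> ('m, 'o) ntrans \<Rightarrow> ('m, 'o) ntrans" where
  "nt_hcomp G \<eta>' \<eta> =
    \<lparr>nt_src = nt_src \<eta>' \<otimes>\<^bsub>ggd_End G\<^esub> nt_src \<eta>,
     nt_tgt = nt_tgt \<eta>' \<otimes>\<^bsub>ggd_End G\<^esub> nt_tgt \<eta>,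
     nt_map = (\<lambda>x \<in> carrier (Obj G).
       cmp G (nt_map \<eta>' (snd (nt_tgt \<eta>) x)) (fst (nt_src \<eta>') (nt_map \<eta> x)))\<rparr>"

definition nt_vcomp ::
  "('m, 'o) ggd \<Rightarrow> ('m, 'o) ntrans \<Rightarrow> ('m, 'o) ntrans \<Rightarrow> ('m, 'o) ntrans" where
  "nt_vcomp G \<zeta> \<eta> =
    \<lparr>nt_src = nt_src \<eta>, nt_tgt = nt_tgt \<zeta>,
     nt_map = (\<lambda>x \<in> carrier (Obj G). cmp G (nt_map \<zeta> x) (nt_map \<eta> x))\<rparr>"

definition Nat_monoid :: "('m, 'o) ggd \<Rightarrow> ('m, 'o) ntrans monoid" where
  "Nat_monoid G =
    \<lparr>carrier = nat_trans G, mult = nt_hcomp G, one = nt_id G \<one>\<^bsub>ggd_End G\<^esub>\<rparr>"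

definition actor_ggd :: "('m, 'o) ggd \<Rightarrow> (('m, 'o) ntrans, ('m, 'o) ggd_map) ggd" where
  "actor_ggd G =
    \<lparr>Mor = units_of (Nat_monoid G), Obj = ggd_Aut G,
     src = nt_src, tgt = nt_tgt, idn = nt_id G, cmp = nt_vcomp G\<rparr>"

section \<open>Crossed modules\<close>

text \<open>\<open>xact X b a\<close> is the action \<open>b \<cdot> a\<close>.\<close>

record ('a, 'b) xmod =
  Top :: "'a monoid"
  Base :: "'b monoid"
  bdry :: "'a \<Rightarrow> 'b"
  xact :: "'b \<Rightarrow> 'a \<Rightarrow> 'a"

locale crossed_module =
  fixes X :: "('a, 'b) xmod"
  assumes group_Top: "group (Top X)"
    and group_Base: "group (Base X)"
    and bdry_hom: "bdry X \<in> hom (Top X) (Base X)"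
    and xact_hom: "b \<in> carrier (Base X) \<Longrightarrow> xact X b \<in> hom (Top X) (Top X)"
    and xact_one: "a \<in> carrier (Top X) \<Longrightarrow> xact X \<one>\<^bsub>Base X\<^esub> a = a"
    and xact_mult: "\<lbrakk>b \<in> carrier (Base X); b' \<in> carrier (Base X); a \<in> carrier (Top X)\<rbrakk>
        \<Longrightarrow> xact X (b \<otimes>\<^bsub>Base X\<^esub> b') a = xact X b (xact X b' a)"
    and bdry_xact: "\<lbrakk>b \<in> carrier (Base X); a \<in> carrier (Top X)\<rbrakk>
        \<Longrightarrow> bdry X (xact X b a) = b \<otimes>\<^bsub>Base X\<^esub> bdry X a \<otimes>\<^bsub>Base X\<^esub> inv\<^bsub>Base X\<^esub> b"
    and peiffer: "\<lbrakk>a \<in> carrier (Top X); a1 \<in> carrier (Top X)\<rbrakk>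
        \<Longrightarrow> xact X (bdry X a) a1 = a \<otimes>\<^bsub>Top X\<^esub> a1 \<otimes>\<^bsub>Top X\<^esub> inv\<^bsub>Top X\<^esub> a"

definition xmod_hom ::
  "('a, 'b) xmod \<Rightarrow> ('c, 'd) xmod \<Rightarrow> (('a \<Rightarrow> 'c) \<times> ('b \<Rightarrow> 'd)) set" where
  "xmod_hom X Y = {(f, g).
     f \<in> hom (Top X) (Top Y) \<and> g \<in> hom (Base X) (Base Y) \<and>
     (\<forall>a \<in> carrier (Top X). g (bdry X a) = bdry Y (f a)) \<and>
     (\<forall>b \<in> carrier (Base X). \<forall>a \<in> carrier (Top X). f (xact X b a) = xact Y (g b) (f a))}"

definition xmod_iso ::
  "('a, 'b) xmod \<Rightarrow> ('c, 'd) xmod \<Rightarrow> (('a \<Rightarrow> 'c) \<times> ('b \<Rightarrow> 'd)) set" where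
  "xmod_iso X Y = {(f, g). (f, g) \<in> xmod_hom X Y \<and>
     (\<exists>(f', g') \<in> xmod_hom Y X.
        group_isomorphisms (Top X) (Top Y) f f' \<and>
        group_isomorphisms (Base X) (Base Y) g g')}"

text \<open>
  The boundary is \<open>d\<^sub>1\<close> restricted to \<open>Ker d\<^sub>0\<close>: the restriction is carried by the carrier of
  the top group, not by the function.
\<close>

definition xmod_of_ggd :: "('m, 'o) ggd \<Rightarrow> ('m, 'o) xmod" where
  "xmod_of_ggd G =
    \<lparr>Top = (Mor G)\<lparr>carrier := kernel (Mor G) (Obj G) (src G)\<rparr>,
     Base = Obj G,
     bdry = tgt G,
     xact = (\<lambda>x a. idn G x \<otimes>\<^bsub>Mor G\<^esub> a \<otimes>\<^bsub>Mor G\<^esub> inv\<^bsub>Mor G\<^esub> (idn G x))\<rparr>"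

section \<open>The actor crossed module\<close>

type_synonym ('a, 'b) xmod_map = "('a \<Rightarrow> 'a) \<times> ('b \<Rightarrow> 'b)"

definition xmod_End :: "('a, 'b) xmod \<Rightarrow> ('a, 'b) xmod_map monoid" where
  "xmod_End X =
    \<lparr>carrier = xmod_hom X X \<inter>
       (extensional (carrier (Top X)) \<times> extensional (carrier (Base X))),
     mult = (\<lambda>(f, g) (f', g').
       (compose (carrier (Top X)) f f', compose (carrier (Base X)) g g')),
     one = (\<lambda>a \<in> carrier (Top X). a, \<lambda>b \<in> carrier (Base X). b)\<rparr>"

definition xmod_Aut :: "('a, 'b) xmod \<Rightarrow> ('a, 'b) xmod_map monoid" where
  "xmod_Aut X = units_of (xmod_End X)"

definition derivations :: "('a, 'b) xmod \<Rightarrow> ('b \<Rightarrow> 'a) set" where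
  "derivations X = {d \<in> carrier (Base X) \<rightarrow>\<^sub>E carrier (Top X).
     \<forall>b \<in> carrier (Base X). \<forall>b1 \<in> carrier (Base X).
       d (b \<otimes>\<^bsub>Base X\<^esub> b1) = d b \<otimes>\<^bsub>Top X\<^esub> xact X b (d b1)}"

definition der_theta :: "('a, 'b) xmod \<Rightarrow> ('b \<Rightarrow> 'a) \<Rightarrow> 'a \<Rightarrow> 'a" where
  "der_theta X d = (\<lambda>a \<in> carrier (Top X). d (bdry X a) \<otimes>\<^bsub>Top X\<^esub> a)"

definition der_sigma :: "('a, 'b) xmod \<Rightarrow> ('b \<Rightarrow> 'a) \<Rightarrow> 'b \<Rightarrow> 'b" where
  "der_sigma X d = (\<lambda>b \<in> carrier (Base X). bdry X (d b) \<otimes>\<^bsub>Base X\<^esub> b)"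

definition Der_monoid :: "('a, 'b) xmod \<Rightarrow> ('b \<Rightarrow> 'a) monoid" where
  "Der_monoid X =
    \<lparr>carrier = derivations X,
     mult = (\<lambda>d d'. \<lambda>b \<in> carrier (Base X). d (der_sigma X d' b) \<otimes>\<^bsub>Top X\<^esub> d' b),
     one = (\<lambda>b \<in> carrier (Base X). \<one>\<^bsub>Top X\<^esub>)\<rparr>"

definition actor_xmod :: "('a, 'b) xmod \<Rightarrow> ('b \<Rightarrow> 'a, ('a, 'b) xmod_map) xmod" where
  "actor_xmod X =
    \<lparr>Top = units_of (Der_monoid X),
     Base = xmod_Aut X,
     bdry = (\<lambda>d. (der_theta X d, der_sigma X d)),
     xact = (\<lambda>(f, g) d. \<lambda>b \<in> carrier (Base X). f (d (inv_into (carrier (Base X)) g b)))\<rparr>"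

section \<open>The comparison maps\<close>

definition xi_map :: "('m, 'o) ggd \<Rightarrow> ('m, 'o) ntrans \<Rightarrow> ('o \<Rightarrow> 'm)" where
  "xi_map G \<eta> =
    (\<lambda>x \<in> carrier (Obj G). nt_map \<eta> x \<otimes>\<^bsub>Mor G\<^esub> inv\<^bsub>Mor G\<^esub> (idn G x))"

definition lambda_map :: "('m, 'o) ggd \<Rightarrow> ('m, 'o) ggd_map \<Rightarrow> ('m, 'o) xmod_map" where
  "lambda_map G = (\<lambda>(f1, f0). (restrict f1 (kernel (Mor G) (Obj G) (src G)), f0))"

end

theory Submission
  imports Defs
begin

text \<open>
  Composition in a group-groupoid is determined by the group structure:
  \<open>b \<circ> a = b - 1 + a = a - 1 + b\<close> with \<open>1\<close> the identity at the middle object. Hence a morphism of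
  group-groupoids is determined by its effect on \<open>Ker d\<^sub>0\<close> and on objects, since
  \<open>a = (a - 1\<^sub>x) + 1\<^sub>x\<close> for \<open>a : x \<rightarrow> y\<close>, and a transformation \<open>\<eta>\<close> out of the identity is
  determined by \<open>d(x) = \<eta>(x) - 1\<^sub>x\<close>, its target being read off from \<open>(\<theta>\<^sub>d, \<sigma>\<^sub>d)\<close>. So \<open>\<xi>\<close> and \<open>\<lambda>\<close> are
  isomorphisms already between the monoids of not necessarily invertible elements. The crossed
  module axioms are easy on the groupoid side, where all but the Peiffer identity are facts about
  conjugation, and they are transported along the isomorphism to the actor crossed module.
\<close>

section \<open>Monoids, units and crossed modules\<close>

text \<open>The unit is part of the notion because \<open>N\<close> need not be known to be a
  monoid: its laws are to be deduced from those of \<open>M\<close>.\<close>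

definition monoid_iso :: "('a, 'x) monoid_scheme \<Rightarrow> ('b, 'y) monoid_scheme \<Rightarrow> ('a \<Rightarrow> 'b) \<Rightarrow> bool" where
  "monoid_iso M N h \<longleftrightarrow> h \<in> iso M N \<and> h \<one>\<^bsub>M\<^esub> = \<one>\<^bsub>N\<^esub>"

lemma monoid_isoI:
  assumes "h \<in> hom M N" "h \<one>\<^bsub>M\<^esub> = \<one>\<^bsub>N\<^esub>" "inj_on h (carrier M)"
    and "\<And>y. y \<in> carrier N \<Longrightarrow> \<exists>x \<in> carrier M. h x = y"
  shows "monoid_iso M N h"
  using assms unfolding monoid_iso_def iso_def bij_betw_def hom_def by (auto simp: image_iff)

text \<open>Transport of structure: every element of \<open>N\<close> is an image, so each law of
  \<open>N\<close> is the image of a law of \<open>M\<close>. In this way the monoid laws for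
  derivations and for endomorphisms of a crossed module come from the groupoid side.\<close>

lemma monoid_iso_imp_monoid:
  assumes "monoid M" "monoid_iso M N h"
  shows "monoid N"
proof -
  interpret M: monoid M by fact
  have surj: "\<exists>x \<in> carrier M. y = h x" if "y \<in> carrier N" for y
    using assms(2) that by (auto simp: monoid_iso_def iso_def bij_betw_def)
  have mult: "h x \<otimes>\<^bsub>N\<^esub> h y = h (x \<otimes>\<^bsub>M\<^esub> y)" if "x \<in> carrier M" "y \<in> carrier M" for x y
    using assms(2) that by (simp add: monoid_iso_def iso_def hom_def)
  have closed: "h x \<in> carrier N" if "x \<in> carrier M" for x
    using assms(2) that by (auto simp: monoid_iso_def iso_def hom_def)
  have one: "\<one>\<^bsub>N\<^esub> = h \<one>\<^bsub>M\<^esub>"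
    using assms(2) by (simp add: monoid_iso_def)
  show ?thesis
    by (rule monoidI) (auto dest!: surj simp: mult closed one M.m_assoc)
qed

lemma Units_hom:
  assumes "h \<in> hom M N" "h \<one>\<^bsub>M\<^esub> = \<one>\<^bsub>N\<^esub>" "x \<in> Units M"
  shows "h x \<in> Units N"
  using assms unfolding Units_def hom_def by simp (metis PiE)

lemma units_of_hom:
  assumes "h \<in> hom M N" "h \<one>\<^bsub>M\<^esub> = \<one>\<^bsub>N\<^esub>" "monoid M"
  shows "h \<in> hom (units_of M) (units_of N)"
proof (rule homI)
  show "h x \<in> carrier (units_of N)" if "x \<in> carrier (units_of M)" for x
    using Units_hom[OF assms(1,2)] that by (simp add: units_of_carrier)
  show "h (x \<otimes>\<^bsub>units_of M\<^esub> y) = h x \<otimes>\<^bsub>units_of N\<^esub> h y"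
    if "x \<in> carrier (units_of M)" "y \<in> carrier (units_of M)" for x y
    using that hom_mult[OF assms(1)] monoid.Units_closed[OF assms(3)]
    by (simp add: units_of_carrier units_of_mult)
qed

text \<open>A pair of mutually inverse elements of \<open>N\<close> lifts along the bijection to a
  pair in \<open>M\<close> whose products have the same image as the unit, hence are the unit by
  injectivity. It is therefore enough to compare monoids of not necessarily invertible
  elements.\<close>

lemma monoid_iso_units_of:
  assumes "monoid_iso M N h" "monoid M"
  shows "h \<in> iso (units_of M) (units_of N)"
proof -
  have h: "h \<in> hom M N" "h \<one>\<^bsub>M\<^esub> = \<one>\<^bsub>N\<^esub>" "inj_on h (carrier M)" "h ` carrier M = carrier N"
    using assms(1) by (auto simp: monoid_iso_def iso_def bij_betw_def)
  have "Units N \<subseteq> h ` Units M"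
  proof
    fix y assume "y \<in> Units N"
    then obtain y' where y: "y \<in> carrier N" "y' \<in> carrier N" "y \<otimes>\<^bsub>N\<^esub> y' = \<one>\<^bsub>N\<^esub>" "y' \<otimes>\<^bsub>N\<^esub> y = \<one>\<^bsub>N\<^esub>"
      by (auto simp: Units_def)
    then obtain x x' where x: "x \<in> carrier M" "x' \<in> carrier M" "y = h x" "y' = h x'"
      using h(4) by (metis imageE)
    have "h (x \<otimes>\<^bsub>M\<^esub> x') = h \<one>\<^bsub>M\<^esub>" "h (x' \<otimes>\<^bsub>M\<^esub> x) = h \<one>\<^bsub>M\<^esub>"
      using x y h(1,2) by (simp_all add: hom_mult)
    then have "x \<otimes>\<^bsub>M\<^esub> x' = \<one>\<^bsub>M\<^esub>" "x' \<otimes>\<^bsub>M\<^esub> x = \<one>\<^bsub>M\<^esub>"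
      using x assms(2) by (auto intro!: inj_onD[OF h(3)] monoid.m_closed monoid.one_closed)
    then show "y \<in> h ` Units M"
      using x by (auto simp: Units_def)
  qed
  moreover have "h ` Units M \<subseteq> Units N"
    using Units_hom[OF h(1,2)] by auto
  moreover have "inj_on h (Units M)"
    using inj_on_subset[OF h(3)] monoid.Units_closed[OF assms(2)] by blast
  ultimately show ?thesis
    using units_of_hom[OF h(1,2) assms(2)] by (auto simp: iso_def bij_betw_def units_of_carrier)
qed

lemma submonoid_hom_kernel:
  assumes "monoid M" "monoid N" "h \<in> hom M N" "h \<one>\<^bsub>M\<^esub> = \<one>\<^bsub>N\<^esub>"
  shows "monoid (M\<lparr>carrier := kernel M N h\<rparr>)"
proof -
  interpret M: monoid M by fact
  interpret N: monoid N by fact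
  show ?thesis
    using assms(3,4) by (intro monoidI) (auto simp: kernel_def hom_mult M.m_assoc)
qed

text \<open>If \<open>h x = \<one>\<close> and \<open>y\<close> is inverse to \<open>x\<close>, then
  \<open>h y = h x \<otimes> h y = h \<one> = \<one>\<close>. So inverses stay in the kernel, and
  passing to units commutes with passing to the kernel.\<close>

lemma units_of_hom_kernel:
  assumes "monoid M" "monoid N" "h \<in> hom M N"
  shows "(units_of M)\<lparr>carrier := kernel (units_of M) (units_of N) h\<rparr>
    = units_of (M\<lparr>carrier := kernel M N h\<rparr>)"
proof -
  interpret M: monoid M by fact
  interpret N: monoid N by fact
  have "h y = \<one>\<^bsub>N\<^esub>"
    if "x \<otimes>\<^bsub>M\<^esub> y = \<one>\<^bsub>M\<^esub>" "h x = \<one>\<^bsub>N\<^esub>" "x \<in> carrier M" "y \<in> carrier M" "h \<one>\<^bsub>M\<^esub> = \<one>\<^bsub>N\<^esub>" for x y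
    using that hom_mult[OF assms(3), of x y] hom_in_carrier[OF assms(3), of y] by simp
  \<comment> \<open>A multiplicative map into a monoid may miss the unit, but an element
    \<open>x\<close> with \<open>h x = \<one>\<close> forces \<open>h \<one> = \<one>\<close>, since
    \<open>h x = h x \<otimes> h \<one>\<close>.\<close>
  moreover have "h \<one>\<^bsub>M\<^esub> = \<one>\<^bsub>N\<^esub>" if "h x = \<one>\<^bsub>N\<^esub>" "x \<in> carrier M" for x
    using that hom_mult[OF assms(3), of x "\<one>\<^bsub>M\<^esub>"] hom_in_carrier[OF assms(3), of "\<one>\<^bsub>M\<^esub>"] by simp
  ultimately have "kernel (units_of M) (units_of N) h = Units (M\<lparr>carrier := kernel M N h\<rparr>)"
    unfolding kernel_def Units_def units_of_def by auto
  then show ?thesis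
    by (simp add: units_of_def)
qed

context group begin

lemma inv_mult_cancel:
  assumes "x \<in> carrier G" "y \<in> carrier G"
  shows "inv x \<otimes> (x \<otimes> y) = y" "x \<otimes> (inv x \<otimes> y) = y"
  using assms by (simp_all flip: m_assoc)

lemmas group_simps = m_assoc inv_mult_group inv_mult_cancel

end

section \<open>Transport and recognition of crossed modules\<close>

text \<open>Elements of \<open>Y\<close> are images of elements of \<open>X\<close>, and boundary
  and action of \<open>Y\<close> are known on images, so each axiom of \<open>Y\<close> is the image
  of the same axiom of \<open>X\<close>. By the same rewriting the inverse group isomorphisms form a
  morphism of crossed modules.\<close>

lemma xmod_iso_transport:
  assumes X: "crossed_module X"
    and groups: "group (Top Y)" "group (Base Y)"
    and f: "f \<in> iso (Top X) (Top Y)"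
    and g: "g \<in> iso (Base X) (Base Y)"
    and bdry: "\<And>a. a \<in> carrier (Top X) \<Longrightarrow> bdry Y (f a) = g (bdry X a)"
    and act: "\<And>b a. \<lbrakk>b \<in> carrier (Base X); a \<in> carrier (Top X)\<rbrakk>
      \<Longrightarrow> xact Y (g b) (f a) = f (xact X b a)"
  shows "crossed_module Y \<and> (f, g) \<in> xmod_iso X Y"
proof
  interpret X: crossed_module X by fact
  interpret tX: group "Top X" by (rule X.group_Top)
  interpret bX: group "Base X" by (rule X.group_Base)
  interpret tY: group "Top Y" by (rule groups)
  interpret bY: group "Base Y" by (rule groups)
  interpret f: group_hom "Top X" "Top Y" f
    using f by unfold_locales (simp add: iso_def)
  interpret g: group_hom "Base X" "Base Y" g
    using g by unfold_locales (simp add: iso_def)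
  have fsurj: "\<exists>x \<in> carrier (Top X). y = f x" if "y \<in> carrier (Top Y)" for y
    using f that by (auto simp: iso_def bij_betw_def)
  have gsurj: "\<exists>x \<in> carrier (Base X). y = g x" if "y \<in> carrier (Base Y)" for y
    using g that by (auto simp: iso_def bij_betw_def)
  have bdry_closed: "bdry X a \<in> carrier (Base X)" if "a \<in> carrier (Top X)" for a
    using X.bdry_hom that by (auto simp: hom_def)
  have act_closed: "xact X b a \<in> carrier (Top X)"
    if "b \<in> carrier (Base X)" "a \<in> carrier (Top X)" for b a
    using X.xact_hom that by (auto simp: hom_def)
  show "crossed_module Y"
  proof (rule crossed_module.intro)
    show "group (Top Y)" "group (Base Y)" by (fact groups)+
    show "bdry Y \<in> hom (Top Y) (Base Y)"
      by (rule homI)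
        (auto dest!: fsurj simp: bdry bdry_closed hom_mult[OF X.bdry_hom] simp flip: f.hom_mult)
    show "xact Y b \<in> hom (Top Y) (Top Y)" if "b \<in> carrier (Base Y)" for b
      using gsurj[OF that]
      by (intro homI)
        (auto dest!: fsurj simp: act act_closed hom_mult[OF X.xact_hom] simp flip: f.hom_mult)
    show "xact Y \<one>\<^bsub>Base Y\<^esub> a = a" if "a \<in> carrier (Top Y)" for a
      using fsurj[OF that] by (auto simp: act X.xact_one simp flip: g.hom_one)
    show "xact Y (b \<otimes>\<^bsub>Base Y\<^esub> b') a = xact Y b (xact Y b' a)"
      if "b \<in> carrier (Base Y)" "b' \<in> carrier (Base Y)" "a \<in> carrier (Top Y)" for b b' a
      using gsurj[OF that(1)] gsurj[OF that(2)] fsurj[OF that(3)]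
      by (auto simp: act act_closed X.xact_mult simp flip: g.hom_mult)
    show "bdry Y (xact Y b a) = b \<otimes>\<^bsub>Base Y\<^esub> bdry Y a \<otimes>\<^bsub>Base Y\<^esub> inv\<^bsub>Base Y\<^esub> b"
      if "b \<in> carrier (Base Y)" "a \<in> carrier (Top Y)" for b a
      using gsurj[OF that(1)] fsurj[OF that(2)]
      by (auto simp: act bdry act_closed bdry_closed X.bdry_xact)
    show "xact Y (bdry Y a) a1 = a \<otimes>\<^bsub>Top Y\<^esub> a1 \<otimes>\<^bsub>Top Y\<^esub> inv\<^bsub>Top Y\<^esub> a"
      if "a \<in> carrier (Top Y)" "a1 \<in> carrier (Top Y)" for a a1
      using fsurj[OF that(1)] fsurj[OF that(2)]
      by (auto simp: act bdry act_closed bdry_closed X.peiffer)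
  qed
  obtain f' g' where f': "group_isomorphisms (Top X) (Top Y) f f'"
    and g': "group_isomorphisms (Base X) (Base Y) g g'"
    using f g tX.iso_iff_group_isomorphisms bX.iso_iff_group_isomorphisms by metis
  have inv: "f' \<in> hom (Top Y) (Top X)" "g' \<in> hom (Base Y) (Base X)"
    "\<And>x. x \<in> carrier (Top X) \<Longrightarrow> f' (f x) = x" "\<And>x. x \<in> carrier (Base X) \<Longrightarrow> g' (g x) = x"
    using f' g' by (simp_all add: group_isomorphisms_def)
  have "(f', g') \<in> xmod_hom Y X"
    unfolding xmod_hom_def
    by (auto simp: inv bdry act bdry_closed act_closed dest!: fsurj gsurj)
  moreover have "(f, g) \<in> xmod_hom X Y"
    unfolding xmod_hom_def using f.homh g.homh by (auto simp: bdry act)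
  ultimately show "(f, g) \<in> xmod_iso X Y"
    unfolding xmod_iso_def using f' g' by blast
qed

text \<open>The action is conjugation by identities, so all axioms but Peiffer follow from
  \<open>idn A\<close> being a homomorphic section of source and target. Peiffer is left as an
  assumption because it has different origins in the two applications: the interchange law for
  \<open>G\<close>, naturality for its actor.\<close>

lemma crossed_module_xmod_of_ggd:
  assumes groups: "group (Mor A)" "group (Obj A)"
    and src: "src A \<in> hom (Mor A) (Obj A)"
    and tgt: "tgt A \<in> hom (Mor A) (Obj A)"
    and idn: "idn A \<in> hom (Obj A) (Mor A)"
    and src_idn: "\<And>x. x \<in> carrier (Obj A) \<Longrightarrow> src A (idn A x) = x"
    and tgt_idn: "\<And>x. x \<in> carrier (Obj A) \<Longrightarrow> tgt A (idn A x) = x"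
    and peiffer: "\<And>a a1. \<lbrakk>a \<in> kernel (Mor A) (Obj A) (src A); a1 \<in> kernel (Mor A) (Obj A) (src A)\<rbrakk>
      \<Longrightarrow> idn A (tgt A a) \<otimes>\<^bsub>Mor A\<^esub> a1 \<otimes>\<^bsub>Mor A\<^esub> inv\<^bsub>Mor A\<^esub> (idn A (tgt A a)) \<otimes>\<^bsub>Mor A\<^esub> a = a \<otimes>\<^bsub>Mor A\<^esub> a1"
  shows "crossed_module (xmod_of_ggd A)"
proof -
  interpret m: group "Mor A" by fact
  interpret o: group "Obj A" by fact
  interpret s: group_hom "Mor A" "Obj A" "src A" using src by unfold_locales
  interpret t: group_hom "Mor A" "Obj A" "tgt A" using tgt by unfold_locales
  interpret i: group_hom "Obj A" "Mor A" "idn A" using idn by unfold_locales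
  let ?K = "kernel (Mor A) (Obj A) (src A)"
  have K: "subgroup ?K (Mor A)" by (rule s.subgroup_kernel)
  have mem: "a \<in> ?K \<longleftrightarrow> a \<in> carrier (Mor A) \<and> src A a = \<one>\<^bsub>Obj A\<^esub>" for a
    by (simp add: kernel_def)
  show ?thesis
  proof (rule crossed_module.intro, unfold xmod_of_ggd_def xmod.simps)
    show "group (Mor A\<lparr>carrier := ?K\<rparr>)"
      by (rule m.subgroup_imp_group[OF K])
    show "group (Obj A)" by fact
    show "tgt A \<in> hom (Mor A\<lparr>carrier := ?K\<rparr>) (Obj A)"
      by (auto simp: hom_def mem)
    show "(\<lambda>a. idn A b \<otimes>\<^bsub>Mor A\<^esub> a \<otimes>\<^bsub>Mor A\<^esub> inv\<^bsub>Mor A\<^esub> idn A b)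
        \<in> hom (Mor A\<lparr>carrier := ?K\<rparr>) (Mor A\<lparr>carrier := ?K\<rparr>)" if "b \<in> carrier (Obj A)" for b
      using that by (auto simp: hom_def mem src_idn m.group_simps)
  next
    fix a assume "a \<in> carrier (Mor A\<lparr>carrier := ?K\<rparr>)"
    then show "idn A \<one>\<^bsub>Obj A\<^esub> \<otimes>\<^bsub>Mor A\<^esub> a \<otimes>\<^bsub>Mor A\<^esub> inv\<^bsub>Mor A\<^esub> idn A \<one>\<^bsub>Obj A\<^esub> = a"
      by (simp add: mem)
  next
    fix b b' a
    assume "b \<in> carrier (Obj A)" "b' \<in> carrier (Obj A)" "a \<in> carrier (Mor A\<lparr>carrier := ?K\<rparr>)"
    then show "idn A (b \<otimes>\<^bsub>Obj A\<^esub> b') \<otimes>\<^bsub>Mor A\<^esub> a \<otimes>\<^bsub>Mor A\<^esub> inv\<^bsub>Mor A\<^esub> idn A (b \<otimes>\<^bsub>Obj A\<^esub> b')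
      = idn A b \<otimes>\<^bsub>Mor A\<^esub> (idn A b' \<otimes>\<^bsub>Mor A\<^esub> a \<otimes>\<^bsub>Mor A\<^esub> inv\<^bsub>Mor A\<^esub> idn A b') \<otimes>\<^bsub>Mor A\<^esub> inv\<^bsub>Mor A\<^esub> idn A b"
      by (simp add: mem m.group_simps)
  next
    fix b a assume "b \<in> carrier (Obj A)" "a \<in> carrier (Mor A\<lparr>carrier := ?K\<rparr>)"
    then show "tgt A (idn A b \<otimes>\<^bsub>Mor A\<^esub> a \<otimes>\<^bsub>Mor A\<^esub> inv\<^bsub>Mor A\<^esub> idn A b)
      = b \<otimes>\<^bsub>Obj A\<^esub> tgt A a \<otimes>\<^bsub>Obj A\<^esub> inv\<^bsub>Obj A\<^esub> b"
      by (simp add: mem tgt_idn)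
  next
    fix a a1
    assume "a \<in> carrier (Mor A\<lparr>carrier := ?K\<rparr>)" "a1 \<in> carrier (Mor A\<lparr>carrier := ?K\<rparr>)"
    then have a: "a \<in> ?K" "a1 \<in> ?K" by simp_all
    moreover have "idn A (tgt A a) \<otimes>\<^bsub>Mor A\<^esub> a1 \<otimes>\<^bsub>Mor A\<^esub> inv\<^bsub>Mor A\<^esub> (idn A (tgt A a)) = a \<otimes>\<^bsub>Mor A\<^esub> a1 \<otimes>\<^bsub>Mor A\<^esub> inv\<^bsub>Mor A\<^esub> a"
      using peiffer[OF a] a by (simp add: mem m.inv_solve_right)
    ultimately show "idn A (tgt A a) \<otimes>\<^bsub>Mor A\<^esub> a1 \<otimes>\<^bsub>Mor A\<^esub> inv\<^bsub>Mor A\<^esub> idn A (tgt A a)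
      = a \<otimes>\<^bsub>Mor A\<lparr>carrier := ?K\<rparr>\<^esub> a1 \<otimes>\<^bsub>Mor A\<lparr>carrier := ?K\<rparr>\<^esub> inv\<^bsub>Mor A\<lparr>carrier := ?K\<rparr>\<^esub> a"
      by (simp add: m.m_inv_consistent[OF K])
  qed
qed

section \<open>The endomorphism induced by a derivation\<close>

context crossed_module begin

text \<open>Expanding \<open>d\<close> on a sum produces
  \<open>xact X (bdry X a) c \<otimes> a\<close>, which the Peiffer identity turns into
  \<open>a \<otimes> c\<close>. This gives both the additivity of \<open>der_theta\<close> and its
  compatibility with the action. The derivation may be irregular, as is needed to compare whole
  monoids.\<close>

lemma der_theta_sigma_End:
  assumes d: "d \<in> derivations X"
  shows "(der_theta X d, der_sigma X d) \<in> carrier (xmod_End X)"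
proof -
  interpret T: group "Top X" by (rule group_Top)
  interpret B: group "Base X" by (rule group_Base)
  interpret bdry: group_hom "Top X" "Base X" "bdry X" by unfold_locales (rule bdry_hom)
  have dc [simp]: "d b \<in> carrier (Top X)" if "b \<in> carrier (Base X)" for b
    using d that by (auto simp: derivations_def)
  have dm: "d (b \<otimes>\<^bsub>Base X\<^esub> c) = d b \<otimes>\<^bsub>Top X\<^esub> xact X b (d c)"
    if "b \<in> carrier (Base X)" "c \<in> carrier (Base X)" for b c
    using d that by (auto simp: derivations_def)
  have xc [simp]: "xact X b a \<in> carrier (Top X)" if "b \<in> carrier (Base X)" "a \<in> carrier (Top X)" for b a
    using hom_in_carrier[OF xact_hom] that by simp
  have xm: "xact X b (a \<otimes>\<^bsub>Top X\<^esub> c) = xact X b a \<otimes>\<^bsub>Top X\<^esub> xact X b c"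
    if "b \<in> carrier (Base X)" "a \<in> carrier (Top X)" "c \<in> carrier (Top X)" for b a c
    using hom_mult[OF xact_hom] that by simp
  have peiffer': "xact X (bdry X a) c \<otimes>\<^bsub>Top X\<^esub> a = a \<otimes>\<^bsub>Top X\<^esub> c"
    if "a \<in> carrier (Top X)" "c \<in> carrier (Top X)" for a c
    using that by (simp add: peiffer T.group_simps)
  have "d \<one>\<^bsub>Base X\<^esub> = d \<one>\<^bsub>Base X\<^esub> \<otimes>\<^bsub>Top X\<^esub> d \<one>\<^bsub>Base X\<^esub>"
    using dm[of "\<one>\<^bsub>Base X\<^esub>" "\<one>\<^bsub>Base X\<^esub>"] by (simp add: xact_one)
  then have d1: "d \<one>\<^bsub>Base X\<^esub> = \<one>\<^bsub>Top X\<^esub>"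
    by simp
  \<comment> \<open>Compatibility of \<open>der_theta\<close> with the action, with
    \<open>bdry X (xact X b a)\<close> already expanded by \<open>bdry_xact\<close>.\<close>
  have conj: "d (b \<otimes>\<^bsub>Base X\<^esub> bdry X a \<otimes>\<^bsub>Base X\<^esub> inv\<^bsub>Base X\<^esub> b) \<otimes>\<^bsub>Top X\<^esub> xact X b a
    = xact X (bdry X (d b) \<otimes>\<^bsub>Base X\<^esub> b) (d (bdry X a) \<otimes>\<^bsub>Top X\<^esub> a)"
    if a: "a \<in> carrier (Top X)" and b: "b \<in> carrier (Base X)" for a b
  proof -
    have "d b \<otimes>\<^bsub>Top X\<^esub> xact X b (d (inv\<^bsub>Base X\<^esub> b)) = \<one>\<^bsub>Top X\<^esub>"
      using dm[of b "inv\<^bsub>Base X\<^esub> b"] b by (simp add: d1)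
    \<comment> \<open>The derivation rule at \<open>b - b = 0\<close> shows that the term
      contributed by \<open>-b\<close> is \<open>- d b\<close>, which completes a conjugation by
      \<open>d b\<close>.\<close>
    then have inv: "xact X b (d (inv\<^bsub>Base X\<^esub> b)) = inv\<^bsub>Top X\<^esub> (d b)"
      using b by (intro T.inv_equality[symmetric]) (simp_all add: T.inv_comm)
    have "d (b \<otimes>\<^bsub>Base X\<^esub> bdry X a \<otimes>\<^bsub>Base X\<^esub> inv\<^bsub>Base X\<^esub> b) \<otimes>\<^bsub>Top X\<^esub> xact X b a
      = d b \<otimes>\<^bsub>Top X\<^esub> xact X b (d (bdry X a) \<otimes>\<^bsub>Top X\<^esub> (xact X (bdry X a) (d (inv\<^bsub>Base X\<^esub> b)) \<otimes>\<^bsub>Top X\<^esub> a))"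
      using a b by (simp add: dm xm B.m_assoc T.m_assoc)
    also have "\<dots> = d b \<otimes>\<^bsub>Top X\<^esub> xact X b (d (bdry X a) \<otimes>\<^bsub>Top X\<^esub> a) \<otimes>\<^bsub>Top X\<^esub> inv\<^bsub>Top X\<^esub> (d b)"
      using a b by (simp add: peiffer' xm inv T.m_assoc)
    \<comment> \<open>By Peiffer, conjugation by \<open>d b\<close> is the action of
      \<open>bdry X (d b)\<close>; it combines with the action of \<open>b\<close> to that of
      \<open>der_sigma X d b\<close>.\<close>
    also have "\<dots> = xact X (bdry X (d b) \<otimes>\<^bsub>Base X\<^esub> b) (d (bdry X a) \<otimes>\<^bsub>Top X\<^esub> a)"
      using a b by (simp add: peiffer xact_mult)
    finally show ?thesis .
  qed
  have "der_theta X d \<in> hom (Top X) (Top X)"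
  proof (rule homI)
    fix a c assume a: "a \<in> carrier (Top X)" "c \<in> carrier (Top X)"
    have "d (bdry X (a \<otimes>\<^bsub>Top X\<^esub> c)) \<otimes>\<^bsub>Top X\<^esub> (a \<otimes>\<^bsub>Top X\<^esub> c)
      = d (bdry X a) \<otimes>\<^bsub>Top X\<^esub> ((xact X (bdry X a) (d (bdry X c)) \<otimes>\<^bsub>Top X\<^esub> a) \<otimes>\<^bsub>Top X\<^esub> c)"
      using a by (simp add: dm T.m_assoc)
    also have "\<dots> = d (bdry X a) \<otimes>\<^bsub>Top X\<^esub> a \<otimes>\<^bsub>Top X\<^esub> (d (bdry X c) \<otimes>\<^bsub>Top X\<^esub> c)"
      using a by (simp only: peiffer' dc bdry.hom_closed) (simp add: T.m_assoc)
    finally show "der_theta X d (a \<otimes>\<^bsub>Top X\<^esub> c) = der_theta X d a \<otimes>\<^bsub>Top X\<^esub> der_theta X d c"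
      using a by (simp add: der_theta_def)
  qed (simp add: der_theta_def)
  moreover have "der_sigma X d \<in> hom (Base X) (Base X)"
    by (rule homI) (simp_all add: der_sigma_def dm bdry_xact B.group_simps)
  ultimately show ?thesis
    using conj by (auto simp: xmod_End_def xmod_hom_def der_theta_def der_sigma_def bdry_xact)
qed

end

section \<open>The actor group-groupoid\<close>

context group_groupoid begin

sublocale mor: group "Mor G" by (rule group_Mor)
sublocale obj: group "Obj G" by (rule group_Obj)
sublocale src: group_hom "Mor G" "Obj G" "src G" by unfold_locales (rule src_hom)
sublocale tgt: group_hom "Mor G" "Obj G" "tgt G" by unfold_locales (rule tgt_hom)
sublocale idn: group_hom "Obj G" "Mor G" "idn G" by unfold_locales (rule idn_hom)

declare src_idn [simp] tgt_idn [simp]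

lemma composable_iff [simp]:
  "(b, a) \<in> composable G \<longleftrightarrow> b \<in> carrier (Mor G) \<and> a \<in> carrier (Mor G) \<and> src G b = tgt G a"
  by (simp add: composable_def)

lemma cmp_closed [simp]:
  "(b, a) \<in> composable G \<Longrightarrow> cmp G b a \<in> carrier (Mor G)"
  using hom_in_carrier[OF cmp_hom, of "(b, a)"] by simp

lemma cmp_idn [simp]:
  "\<lbrakk>a \<in> carrier (Mor G); x = tgt G a\<rbrakk> \<Longrightarrow> cmp G (idn G x) a = a"
  "\<lbrakk>a \<in> carrier (Mor G); x = src G a\<rbrakk> \<Longrightarrow> cmp G a (idn G x) = a"
  by (simp_all add: cmp_idn_left cmp_idn_right)

lemma interchange:
  assumes "(b, a) \<in> composable G" "(d, c) \<in> composable G"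
  shows "cmp G (b \<otimes>\<^bsub>Mor G\<^esub> d) (a \<otimes>\<^bsub>Mor G\<^esub> c) = cmp G b a \<otimes>\<^bsub>Mor G\<^esub> cmp G d c"
  using hom_mult[OF cmp_hom, of "(b, a)" "(d, c)"] assms by simp

text \<open>Write \<open>b\<close> as \<open>b + 0\<close> and \<open>a\<close> as
  \<open>1 + (-1 + a)\<close>, with \<open>1\<close> the identity at the middle object. The
  interchange law splits the composite into \<open>b \<circ> 1\<close> and
  \<open>0 \<circ> (-1 + a)\<close>, both composites with identities, since \<open>0\<close> is the
  identity at the zero object.\<close>

lemma cmp_eq:
  assumes "b \<in> carrier (Mor G)" "a \<in> carrier (Mor G)" "src G b = tgt G a"
  shows "cmp G b a = b \<otimes>\<^bsub>Mor G\<^esub> (inv\<^bsub>Mor G\<^esub> idn G (src G b) \<otimes>\<^bsub>Mor G\<^esub> a)"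
proof -
  let ?i = "idn G (src G b)"
  let ?c = "inv\<^bsub>Mor G\<^esub> ?i \<otimes>\<^bsub>Mor G\<^esub> a"
  have "cmp G b a = cmp G (b \<otimes>\<^bsub>Mor G\<^esub> \<one>\<^bsub>Mor G\<^esub>) (?i \<otimes>\<^bsub>Mor G\<^esub> ?c)"
    using assms by (simp add: mor.inv_mult_cancel)
  also have "\<dots> = cmp G b ?i \<otimes>\<^bsub>Mor G\<^esub> cmp G \<one>\<^bsub>Mor G\<^esub> ?c"
    using assms by (intro interchange) simp_all
  also have "cmp G b ?i = b"
    using assms by (intro cmp_idn_right)
  also have "cmp G \<one>\<^bsub>Mor G\<^esub> ?c = ?c"
    using assms cmp_idn_left[of ?c] by simp
  finally show ?thesis .
qed

text \<open>The mirror image of \<open>cmp_eq\<close>, splitting \<open>b\<close> as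
  \<open>1 + (-1 + b)\<close> and \<open>a\<close> as \<open>a + 0\<close>. Having two expressions
  for one composite yields commutation relations.\<close>

lemma cmp_eq':
  assumes "b \<in> carrier (Mor G)" "a \<in> carrier (Mor G)" "src G b = tgt G a"
  shows "cmp G b a = a \<otimes>\<^bsub>Mor G\<^esub> (inv\<^bsub>Mor G\<^esub> idn G (src G b) \<otimes>\<^bsub>Mor G\<^esub> b)"
proof -
  let ?i = "idn G (src G b)"
  let ?c = "inv\<^bsub>Mor G\<^esub> ?i \<otimes>\<^bsub>Mor G\<^esub> b"
  have "cmp G b a = cmp G (?i \<otimes>\<^bsub>Mor G\<^esub> ?c) (a \<otimes>\<^bsub>Mor G\<^esub> \<one>\<^bsub>Mor G\<^esub>)"
    using assms by (simp add: mor.inv_mult_cancel)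
  also have "\<dots> = cmp G ?i a \<otimes>\<^bsub>Mor G\<^esub> cmp G ?c \<one>\<^bsub>Mor G\<^esub>"
    using assms by (intro interchange) simp_all
  also have "cmp G ?i a = a"
    using assms cmp_idn_left[of a] by simp
  also have "cmp G ?c \<one>\<^bsub>Mor G\<^esub> = ?c"
    using assms cmp_idn_right[of ?c] by simp
  finally show ?thesis .
qed

text \<open>Let \<open>1\<close> be the identity at the target of \<open>a\<close>. Then
  \<open>-1 + a\<close> has target zero and \<open>a1\<close> has source zero, so they are
  composable; the two formulas for their composite say that they commute, which is the Peiffer
  identity up to adding \<open>1\<close> on the left.\<close>

lemma crossed_module_xmod: "crossed_module (xmod_of_ggd G)"
proof (rule crossed_module_xmod_of_ggd)
  fix a a1
  assume "a \<in> kernel (Mor G) (Obj G) (src G)" "a1 \<in> kernel (Mor G) (Obj G) (src G)"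
  then have a: "a \<in> carrier (Mor G)" "a1 \<in> carrier (Mor G)" "src G a = \<one>\<^bsub>Obj G\<^esub>" "src G a1 = \<one>\<^bsub>Obj G\<^esub>"
    by (simp_all add: kernel_def)
  let ?i = "idn G (tgt G a)"
  have "(inv\<^bsub>Mor G\<^esub> ?i \<otimes>\<^bsub>Mor G\<^esub> a) \<otimes>\<^bsub>Mor G\<^esub> a1 = a1 \<otimes>\<^bsub>Mor G\<^esub> (inv\<^bsub>Mor G\<^esub> ?i \<otimes>\<^bsub>Mor G\<^esub> a)"
    using cmp_eq[of a1 "inv\<^bsub>Mor G\<^esub> ?i \<otimes>\<^bsub>Mor G\<^esub> a"] cmp_eq'[of a1 "inv\<^bsub>Mor G\<^esub> ?i \<otimes>\<^bsub>Mor G\<^esub> a"] a by simp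
  then have "?i \<otimes>\<^bsub>Mor G\<^esub> ((inv\<^bsub>Mor G\<^esub> ?i \<otimes>\<^bsub>Mor G\<^esub> a) \<otimes>\<^bsub>Mor G\<^esub> a1) = ?i \<otimes>\<^bsub>Mor G\<^esub> (a1 \<otimes>\<^bsub>Mor G\<^esub> (inv\<^bsub>Mor G\<^esub> ?i \<otimes>\<^bsub>Mor G\<^esub> a))"
    by (rule arg_cong)
  then show "?i \<otimes>\<^bsub>Mor G\<^esub> a1 \<otimes>\<^bsub>Mor G\<^esub> inv\<^bsub>Mor G\<^esub> ?i \<otimes>\<^bsub>Mor G\<^esub> a = a \<otimes>\<^bsub>Mor G\<^esub> a1"
    using a by (simp add: mor.group_simps)
qed (simp_all add: group_Mor group_Obj src_hom tgt_hom idn_hom)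

section \<open>The monoid of endomorphisms of \<open>G\<close>\<close>

text \<open>The point is preservation of composition: by \<open>cmp_eq\<close> a composite is built
  from the group operations, the source and the identities, and the conditions on the right preserve
  all of these.\<close>

lemma End_iff:
  "f \<in> carrier (ggd_End G) \<longleftrightarrow>
    fst f \<in> hom (Mor G) (Mor G) \<and> snd f \<in> hom (Obj G) (Obj G) \<and>
    fst f \<in> extensional (carrier (Mor G)) \<and> snd f \<in> extensional (carrier (Obj G)) \<and>
    (\<forall>a \<in> carrier (Mor G). src G (fst f a) = snd f (src G a) \<and> tgt G (fst f a) = snd f (tgt G a)) \<and>
    (\<forall>x \<in> carrier (Obj G). fst f (idn G x) = idn G (snd f x))"
    (is "_ \<longleftrightarrow> ?R")
proof
  assume ?R
  then have R: "fst f \<in> hom (Mor G) (Mor G)" "snd f \<in> hom (Obj G) (Obj G)"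
    "fst f \<in> extensional (carrier (Mor G))" "snd f \<in> extensional (carrier (Obj G))"
    "\<And>a. a \<in> carrier (Mor G) \<Longrightarrow> src G (fst f a) = snd f (src G a)"
    "\<And>a. a \<in> carrier (Mor G) \<Longrightarrow> tgt G (fst f a) = snd f (tgt G a)"
    "\<And>x. x \<in> carrier (Obj G) \<Longrightarrow> fst f (idn G x) = idn G (snd f x)"
    by simp_all
  interpret f1: group_hom "Mor G" "Mor G" "fst f" using R(1) by unfold_locales
  have "fst f (cmp G b a) = cmp G (fst f b) (fst f a)"
    if "b \<in> carrier (Mor G)" "a \<in> carrier (Mor G)" "src G b = tgt G a" for a b
    using that by (simp add: cmp_eq R(5-7))
  then show "f \<in> carrier (ggd_End G)"
    using R by (auto simp: ggd_End_def ggd_hom_def split_beta mem_Times_iff)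
qed (auto simp: ggd_End_def ggd_hom_def split_beta mem_Times_iff)

lemma End_extensional:
  assumes "f \<in> carrier (ggd_End G)"
  shows "fst f \<in> extensional (carrier (Mor G))" "snd f \<in> extensional (carrier (Obj G))"
  using assms by (simp_all add: End_iff)

context
  fixes f assumes f: "f \<in> carrier (ggd_End G)"
begin

interpretation f1: group_hom "Mor G" "Mor G" "fst f" using f by unfold_locales (simp add: End_iff)
interpretation f0: group_hom "Obj G" "Obj G" "snd f" using f by unfold_locales (simp add: End_iff)

lemma End_closed [simp]:
  "a \<in> carrier (Mor G) \<Longrightarrow> fst f a \<in> carrier (Mor G)"
  "x \<in> carrier (Obj G) \<Longrightarrow> snd f x \<in> carrier (Obj G)"
  by simp_all

lemma End_one [simp]:
  "fst f \<one>\<^bsub>Mor G\<^esub> = \<one>\<^bsub>Mor G\<^esub>"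
  "snd f \<one>\<^bsub>Obj G\<^esub> = \<one>\<^bsub>Obj G\<^esub>"
  by simp_all

lemma End_mult [simp]:
  "a \<in> carrier (Mor G) \<Longrightarrow> b \<in> carrier (Mor G) \<Longrightarrow> fst f (a \<otimes>\<^bsub>Mor G\<^esub> b) = fst f a \<otimes>\<^bsub>Mor G\<^esub> fst f b"
  "x \<in> carrier (Obj G) \<Longrightarrow> y \<in> carrier (Obj G) \<Longrightarrow> snd f (x \<otimes>\<^bsub>Obj G\<^esub> y) = snd f x \<otimes>\<^bsub>Obj G\<^esub> snd f y"
  by simp_all

lemma End_inv [simp]:
  "a \<in> carrier (Mor G) \<Longrightarrow> fst f (inv\<^bsub>Mor G\<^esub> a) = inv\<^bsub>Mor G\<^esub> (fst f a)"
  by simp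

lemma End_src_tgt [simp]:
  "a \<in> carrier (Mor G) \<Longrightarrow> src G (fst f a) = snd f (src G a)"
  "a \<in> carrier (Mor G) \<Longrightarrow> tgt G (fst f a) = snd f (tgt G a)"
  using End_iff[THEN iffD1, OF f] by blast+

lemma End_idn [simp]:
  "x \<in> carrier (Obj G) \<Longrightarrow> fst f (idn G x) = idn G (snd f x)"
  using End_iff[THEN iffD1, OF f] by blast

lemma End_cmp [simp]:
  "\<lbrakk>b \<in> carrier (Mor G); a \<in> carrier (Mor G); src G b = tgt G a\<rbrakk>
    \<Longrightarrow> fst f (cmp G b a) = cmp G (fst f b) (fst f a)"
  by (simp add: cmp_eq)

end

lemma End_eqI:
  assumes "f \<in> carrier (ggd_End G)" "g \<in> carrier (ggd_End G)"
    and "\<And>a. a \<in> carrier (Mor G) \<Longrightarrow> fst f a = fst g a"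
    and "\<And>x. x \<in> carrier (Obj G) \<Longrightarrow> snd f x = snd g x"
  shows "f = g"
proof (rule prod_eqI)
  show "fst f = fst g"
    by (rule extensionalityI[OF _ _ assms(3)]) (use assms(1,2) in \<open>simp_all add: End_extensional\<close>)
  show "snd f = snd g"
    by (rule extensionalityI[OF _ _ assms(4)]) (use assms(1,2) in \<open>simp_all add: End_extensional\<close>)
qed

lemma End_compose [simp]:
  "a \<in> carrier (Mor G) \<Longrightarrow> fst (f \<otimes>\<^bsub>ggd_End G\<^esub> g) a = fst f (fst g a)"
  "x \<in> carrier (Obj G) \<Longrightarrow> snd (f \<otimes>\<^bsub>ggd_End G\<^esub> g) x = snd f (snd g x)"
  by (simp_all add: ggd_End_def split_beta compose_def)

lemma End_id [simp]:
  "a \<in> carrier (Mor G) \<Longrightarrow> fst \<one>\<^bsub>ggd_End G\<^esub> a = a"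
  "x \<in> carrier (Obj G) \<Longrightarrow> snd \<one>\<^bsub>ggd_End G\<^esub> x = x"
  by (simp_all add: ggd_End_def)

lemma monoid_End: "monoid (ggd_End G)"
proof (rule monoidI)
  show closed: "f \<otimes>\<^bsub>ggd_End G\<^esub> g \<in> carrier (ggd_End G)"
    if "f \<in> carrier (ggd_End G)" "g \<in> carrier (ggd_End G)" for f g
  proof -
    have "fst (f \<otimes>\<^bsub>ggd_End G\<^esub> g) \<in> extensional (carrier (Mor G))"
      "snd (f \<otimes>\<^bsub>ggd_End G\<^esub> g) \<in> extensional (carrier (Obj G))"
      by (simp_all add: ggd_End_def split_beta)
    then show ?thesis
      using that by (subst End_iff) (auto intro!: homI)
  qed
  show one: "\<one>\<^bsub>ggd_End G\<^esub> \<in> carrier (ggd_End G)"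
  proof -
    have "fst \<one>\<^bsub>ggd_End G\<^esub> \<in> extensional (carrier (Mor G))"
      "snd \<one>\<^bsub>ggd_End G\<^esub> \<in> extensional (carrier (Obj G))"
      by (simp_all add: ggd_End_def)
    then show ?thesis
      by (subst End_iff) (auto intro!: homI)
  qed
  show "f \<otimes>\<^bsub>ggd_End G\<^esub> g \<otimes>\<^bsub>ggd_End G\<^esub> h = f \<otimes>\<^bsub>ggd_End G\<^esub> (g \<otimes>\<^bsub>ggd_End G\<^esub> h)"
    if "f \<in> carrier (ggd_End G)" "g \<in> carrier (ggd_End G)" "h \<in> carrier (ggd_End G)" for f g h
    using that by (intro End_eqI closed) simp_all
  show "\<one>\<^bsub>ggd_End G\<^esub> \<otimes>\<^bsub>ggd_End G\<^esub> f = f" "f \<otimes>\<^bsub>ggd_End G\<^esub> \<one>\<^bsub>ggd_End G\<^esub> = f"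
    if "f \<in> carrier (ggd_End G)" for f
    using that by (auto intro!: End_eqI closed one)
qed

sublocale End: monoid "ggd_End G" by (rule monoid_End)

section \<open>Natural transformations under horizontal composition\<close>

context
  fixes \<eta> assumes \<eta>: "\<eta> \<in> nat_trans G"
begin

lemmas nat_transD = \<eta>[unfolded nat_trans_def mem_Collect_eq]

lemma nat_trans_src_tgt_End [simp]:
  "nt_src \<eta> \<in> carrier (ggd_End G)" "nt_tgt \<eta> \<in> carrier (ggd_End G)"
  using nat_transD by blast+

lemma nat_trans_extensional: "nt_map \<eta> \<in> extensional (carrier (Obj G))"
  using nat_transD by blast

interpretation \<eta>: group_hom "Obj G" "Mor G" "nt_map \<eta>"
  by unfold_locales (use nat_transD in blast)

lemma nat_trans_closed [simp]:
  "x \<in> carrier (Obj G) \<Longrightarrow> nt_map \<eta> x \<in> carrier (Mor G)"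
  by simp

lemma nat_trans_one [simp]: "nt_map \<eta> \<one>\<^bsub>Obj G\<^esub> = \<one>\<^bsub>Mor G\<^esub>"
  by simp

lemma nat_trans_mult [simp]:
  "\<lbrakk>x \<in> carrier (Obj G); y \<in> carrier (Obj G)\<rbrakk>
    \<Longrightarrow> nt_map \<eta> (x \<otimes>\<^bsub>Obj G\<^esub> y) = nt_map \<eta> x \<otimes>\<^bsub>Mor G\<^esub> nt_map \<eta> y"
  by simp

lemma nat_trans_src_tgt [simp]:
  "x \<in> carrier (Obj G) \<Longrightarrow> src G (nt_map \<eta> x) = snd (nt_src \<eta>) x"
  "x \<in> carrier (Obj G) \<Longrightarrow> tgt G (nt_map \<eta> x) = snd (nt_tgt \<eta>) x"
  using nat_transD by blast+

lemma naturality: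
  "a \<in> carrier (Mor G) \<Longrightarrow>
    cmp G (nt_map \<eta> (tgt G a)) (fst (nt_src \<eta>) a) = cmp G (fst (nt_tgt \<eta>) a) (nt_map \<eta> (src G a))"
  using nat_transD by blast

end

lemma nat_trans_eqI:
  assumes "\<eta> \<in> nat_trans G" "\<zeta> \<in> nat_trans G" "nt_src \<eta> = nt_src \<zeta>" "nt_tgt \<eta> = nt_tgt \<zeta>"
    and "\<And>x. x \<in> carrier (Obj G) \<Longrightarrow> nt_map \<eta> x = nt_map \<zeta> x"
  shows "\<eta> = \<zeta>"
proof -
  have "nt_map \<eta> = nt_map \<zeta>"
    by (rule extensionalityI[OF _ _ assms(5)]) (simp_all add: nat_trans_extensional assms(1,2))
  then show ?thesis
    using assms(3,4) by simp
qed

lemma nt_hcomp_simps [simp]: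
  "nt_src (nt_hcomp G \<eta>' \<eta>) = nt_src \<eta>' \<otimes>\<^bsub>ggd_End G\<^esub> nt_src \<eta>"
  "nt_tgt (nt_hcomp G \<eta>' \<eta>) = nt_tgt \<eta>' \<otimes>\<^bsub>ggd_End G\<^esub> nt_tgt \<eta>"
  "x \<in> carrier (Obj G) \<Longrightarrow> nt_map (nt_hcomp G \<eta>' \<eta>) x =
    cmp G (nt_map \<eta>' (snd (nt_tgt \<eta>) x)) (fst (nt_src \<eta>') (nt_map \<eta> x))"
  by (simp_all add: nt_hcomp_def)

lemma nt_id_simps [simp]:
  "nt_src (nt_id G f) = f" "nt_tgt (nt_id G f) = f"
  "x \<in> carrier (Obj G) \<Longrightarrow> nt_map (nt_id G f) x = idn G (snd f x)"
  by (simp_all add: nt_id_def)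

lemma nt_id_nat_trans:
  assumes f: "f \<in> carrier (ggd_End G)"
  shows "nt_id G f \<in> nat_trans G"
  unfolding nat_trans_def mem_Collect_eq using f by (auto simp: nt_id_def intro!: homI)

text \<open>For naturality, the source of \<open>\<eta>'\<close> is applied to the square of
  \<open>\<eta>\<close> at \<open>a\<close>, and the result is pasted with the square of
  \<open>\<eta>'\<close> at \<open>g(a)\<close>, where \<open>g\<close> is the target of
  \<open>\<eta>\<close>. Additivity of the composite is the interchange law.\<close>

lemma nt_hcomp_nat_trans:
  assumes \<eta>': "\<eta>' \<in> nat_trans G" and \<eta>: "\<eta> \<in> nat_trans G"
  shows "nt_hcomp G \<eta>' \<eta> \<in> nat_trans G"
proof -
  let ?f = "nt_src \<eta>" and ?g = "nt_tgt \<eta>" and ?f' = "nt_src \<eta>'" and ?g' = "nt_tgt \<eta>'"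
  have "cmp G (nt_map (nt_hcomp G \<eta>' \<eta>) (tgt G a)) (fst ?f' (fst ?f a))
    = cmp G (fst ?g' (fst ?g a)) (nt_map (nt_hcomp G \<eta>' \<eta>) (src G a))"
    if a: "a \<in> carrier (Mor G)" for a
  proof -
    let ?x = "src G a" and ?y = "tgt G a"
    have "cmp G (nt_map (nt_hcomp G \<eta>' \<eta>) ?y) (fst ?f' (fst ?f a))
      = cmp G (nt_map \<eta>' (snd ?g ?y)) (cmp G (fst ?f' (nt_map \<eta> ?y)) (fst ?f' (fst ?f a)))"
      using \<eta> \<eta>' a by (simp add: cmp_assoc)
    also have "cmp G (fst ?f' (nt_map \<eta> ?y)) (fst ?f' (fst ?f a))
      = fst ?f' (cmp G (nt_map \<eta> ?y) (fst ?f a))"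
      using \<eta> \<eta>' a by simp
    also have "\<dots> = cmp G (fst ?f' (fst ?g a)) (fst ?f' (nt_map \<eta> ?x))"
      using \<eta> \<eta>' a by (simp add: naturality)
    also have "cmp G (nt_map \<eta>' (snd ?g ?y)) \<dots>
      = cmp G (cmp G (nt_map \<eta>' (tgt G (fst ?g a))) (fst ?f' (fst ?g a))) (fst ?f' (nt_map \<eta> ?x))"
      using \<eta> \<eta>' a by (simp add: cmp_assoc)
    also have "\<dots> = cmp G (cmp G (fst ?g' (fst ?g a)) (nt_map \<eta>' (snd ?g ?x))) (fst ?f' (nt_map \<eta> ?x))"
      using \<eta> \<eta>' a by (subst naturality) simp_all
    also have "\<dots> = cmp G (fst ?g' (fst ?g a)) (nt_map (nt_hcomp G \<eta>' \<eta>) ?x)"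
      using \<eta> \<eta>' a by (simp add: cmp_assoc)
    finally show ?thesis .
  qed
  moreover have "nt_map (nt_hcomp G \<eta>' \<eta>) \<in> hom (Obj G) (Mor G)"
    using \<eta> \<eta>' by (intro homI) (simp_all add: interchange)
  moreover have "nt_map (nt_hcomp G \<eta>' \<eta>) \<in> extensional (carrier (Obj G))"
    by (simp add: nt_hcomp_def)
  ultimately show ?thesis
    unfolding nat_trans_def mem_Collect_eq using \<eta> \<eta>' by (simp add: src_cmp tgt_cmp)
qed

lemma Nat_simps [simp]:
  "carrier (Nat_monoid G) = nat_trans G"
  "mult (Nat_monoid G) = nt_hcomp G"
  "one (Nat_monoid G) = nt_id G \<one>\<^bsub>ggd_End G\<^esub>"
  by (simp_all add: Nat_monoid_def)

lemma monoid_Nat: "monoid (Nat_monoid G)"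
proof (rule monoidI, unfold Nat_simps)
  show "nt_hcomp G \<eta> \<zeta> \<in> nat_trans G" if "\<eta> \<in> nat_trans G" "\<zeta> \<in> nat_trans G" for \<eta> \<zeta>
    using that by (rule nt_hcomp_nat_trans)
  show "nt_id G \<one>\<^bsub>ggd_End G\<^esub> \<in> nat_trans G"
    by (simp add: nt_id_nat_trans)
  show "nt_hcomp G (nt_hcomp G \<eta> \<zeta>) \<theta> = nt_hcomp G \<eta> (nt_hcomp G \<zeta> \<theta>)"
    if "\<eta> \<in> nat_trans G" "\<zeta> \<in> nat_trans G" "\<theta> \<in> nat_trans G" for \<eta> \<zeta> \<theta>
    using that by (intro nat_trans_eqI nt_hcomp_nat_trans) (simp_all add: End.m_assoc cmp_assoc)
  show "nt_hcomp G (nt_id G \<one>\<^bsub>ggd_End G\<^esub>) \<eta> = \<eta>" if "\<eta> \<in> nat_trans G" for \<eta>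
    using that by (intro nat_trans_eqI nt_hcomp_nat_trans nt_id_nat_trans) simp_all
  show "nt_hcomp G \<eta> (nt_id G \<one>\<^bsub>ggd_End G\<^esub>) = \<eta>" if "\<eta> \<in> nat_trans G" for \<eta>
    using that by (intro nat_trans_eqI nt_hcomp_nat_trans nt_id_nat_trans) simp_all
qed

text \<open>The rewrites keep the inherited monoid laws in the normal form produced by
  \<open>Nat_simps\<close>.\<close>

sublocale Nat: monoid "Nat_monoid G"
  rewrites "carrier (Nat_monoid G) = nat_trans G"
    and "mult (Nat_monoid G) = nt_hcomp G"
    and "one (Nat_monoid G) = nt_id G \<one>\<^bsub>ggd_End G\<^esub>"
  using monoid_Nat by simp_all

section \<open>The crossed module of the actor\<close>

lemma nt_src_hom: "nt_src \<in> hom (Nat_monoid G) (ggd_End G)"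
  by (rule homI) simp_all

lemma nt_tgt_hom: "nt_tgt \<in> hom (Nat_monoid G) (ggd_End G)"
  by (rule homI) simp_all

lemma nt_id_hom: "nt_id G \<in> hom (ggd_End G) (Nat_monoid G)"
proof (rule homI)
  fix f g assume fg: "f \<in> carrier (ggd_End G)" "g \<in> carrier (ggd_End G)"
  then show "nt_id G (f \<otimes>\<^bsub>ggd_End G\<^esub> g) = nt_id G f \<otimes>\<^bsub>Nat_monoid G\<^esub> nt_id G g"
    by (intro nat_trans_eqI) (simp_all add: nt_id_nat_trans nt_hcomp_nat_trans)
qed (simp add: nt_id_nat_trans)

text \<open>Composites with identity morphisms collapse. With \<open>h\<close> the inverse of
  \<open>f\<close> this computes the action of \<open>f\<close> on the kernel of the source
  map.\<close>

lemma nt_id_conj: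
  assumes "\<eta> \<in> nat_trans G" "nt_src \<eta> = \<one>\<^bsub>ggd_End G\<^esub>" "f \<in> carrier (ggd_End G)" "h \<in> carrier (ggd_End G)"
    and x: "x \<in> carrier (Obj G)"
  shows "nt_map (nt_hcomp G (nt_hcomp G (nt_id G f) \<eta>) (nt_id G h)) x = fst f (nt_map \<eta> (snd h x))"
  using assms by simp

text \<open>Being a homomorphism between the groups of units, \<open>nt_id G\<close> commutes with
  inverses. This turns conjugation by \<open>nt_id G f\<close> into horizontal composition with the
  identities of \<open>f\<close> and of its inverse.\<close>

lemma units_of_inv_nt_id:
  assumes f: "f \<in> Units (ggd_End G)"
  shows "inv\<^bsub>units_of (Nat_monoid G)\<^esub> (nt_id G f) = nt_id G (inv\<^bsub>ggd_End G\<^esub> f)"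
proof -
  interpret group_hom "units_of (ggd_End G)" "units_of (Nat_monoid G)" "nt_id G"
    using End.units_group monoid.units_group[OF monoid_Nat] units_of_hom[OF nt_id_hom _ monoid_End]
    by (intro group_hom.intro group_hom_axioms.intro) simp_all
  show ?thesis
    using hom_inv[of f] f by (simp add: units_of_carrier End.units_of_inv)
qed

lemma actor_simps [simp]:
  "Mor (actor_ggd G) = units_of (Nat_monoid G)" "Obj (actor_ggd G) = units_of (ggd_End G)"
  "src (actor_ggd G) = nt_src" "tgt (actor_ggd G) = nt_tgt" "idn (actor_ggd G) = nt_id G"
  by (simp_all add: actor_ggd_def ggd_Aut_def)

text \<open>The Peiffer identity of the actor is the naturality square of \<open>\<eta>\<close> at \<open>\<zeta>(x)\<close>.\<close>

lemma actor_peiffer: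
  assumes \<eta>: "\<eta> \<in> nat_trans G" "nt_src \<eta> = \<one>\<^bsub>ggd_End G\<^esub>"
    and \<zeta>: "\<zeta> \<in> nat_trans G" "nt_src \<zeta> = \<one>\<^bsub>ggd_End G\<^esub>"
    and h: "h \<in> carrier (ggd_End G)" "h \<otimes>\<^bsub>ggd_End G\<^esub> nt_tgt \<eta> = \<one>\<^bsub>ggd_End G\<^esub>"
      "nt_tgt \<eta> \<otimes>\<^bsub>ggd_End G\<^esub> h = \<one>\<^bsub>ggd_End G\<^esub>"
  shows "nt_hcomp G (nt_hcomp G (nt_hcomp G (nt_id G (nt_tgt \<eta>)) \<zeta>) (nt_id G h)) \<eta> = nt_hcomp G \<eta> \<zeta>"
proof (rule nat_trans_eqI)
  show "nt_hcomp G (nt_hcomp G (nt_hcomp G (nt_id G (nt_tgt \<eta>)) \<zeta>) (nt_id G h)) \<eta> \<in> nat_trans G"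
    "nt_hcomp G \<eta> \<zeta> \<in> nat_trans G"
    using assms by (simp_all add: nt_hcomp_nat_trans nt_id_nat_trans)
  show "nt_src (nt_hcomp G (nt_hcomp G (nt_hcomp G (nt_id G (nt_tgt \<eta>)) \<zeta>) (nt_id G h)) \<eta>)
    = nt_src (nt_hcomp G \<eta> \<zeta>)"
    using assms by simp
  show "nt_tgt (nt_hcomp G (nt_hcomp G (nt_hcomp G (nt_id G (nt_tgt \<eta>)) \<zeta>) (nt_id G h)) \<eta>)
    = nt_tgt (nt_hcomp G \<eta> \<zeta>)"
    using assms by (simp add: End.m_assoc)
  fix x assume x: "x \<in> carrier (Obj G)"
  have hx: "snd h (snd (nt_tgt \<eta>) x) = x"
    using End_compose(2)[OF x, of h "nt_tgt \<eta>"] x h by simp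
  \<comment> \<open>By \<open>hx\<close> the conjugate of \<open>\<zeta>\<close> contributes
    \<open>g(\<zeta>(x))\<close>, with \<open>g\<close> the target of \<open>\<eta>\<close>. Writing
    \<open>x\<close> as the source of \<open>\<zeta>(x)\<close> exhibits one side of the naturality
    square.\<close>
  have "nt_map (nt_hcomp G (nt_hcomp G (nt_hcomp G (nt_id G (nt_tgt \<eta>)) \<zeta>) (nt_id G h)) \<eta>) x
    = cmp G (fst (nt_tgt \<eta>) (nt_map \<zeta> x)) (nt_map \<eta> (src G (nt_map \<zeta> x)))"
    using assms x hx by (subst nt_hcomp_simps) (simp_all add: nt_id_conj)
  also have "\<dots> = nt_map (nt_hcomp G \<eta> \<zeta>) x"
    using assms x by (subst naturality[symmetric]) simp_all
  finally show "nt_map (nt_hcomp G (nt_hcomp G (nt_hcomp G (nt_id G (nt_tgt \<eta>)) \<zeta>) (nt_id G h)) \<eta>) x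
    = nt_map (nt_hcomp G \<eta> \<zeta>) x" .
qed

lemma crossed_module_actor_ggd: "crossed_module (xmod_of_ggd (actor_ggd G))"
proof (rule crossed_module_xmod_of_ggd, unfold actor_simps)
  show "group (units_of (Nat_monoid G))" "group (units_of (ggd_End G))"
    using monoid.units_group[OF monoid_Nat] End.units_group by simp_all
  show "nt_src \<in> hom (units_of (Nat_monoid G)) (units_of (ggd_End G))"
    "nt_tgt \<in> hom (units_of (Nat_monoid G)) (units_of (ggd_End G))"
    "nt_id G \<in> hom (units_of (ggd_End G)) (units_of (Nat_monoid G))"
    by (simp_all add: units_of_hom nt_src_hom nt_tgt_hom nt_id_hom monoid_Nat monoid_End)
  fix \<eta> \<zeta>
  assume "\<eta> \<in> kernel (units_of (Nat_monoid G)) (units_of (ggd_End G)) nt_src"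
    "\<zeta> \<in> kernel (units_of (Nat_monoid G)) (units_of (ggd_End G)) nt_src"
  then have \<eta>: "\<eta> \<in> Units (Nat_monoid G)" "nt_src \<eta> = \<one>\<^bsub>ggd_End G\<^esub>"
    and \<zeta>: "\<zeta> \<in> Units (Nat_monoid G)" "nt_src \<zeta> = \<one>\<^bsub>ggd_End G\<^esub>"
    by (simp_all add: kernel_def units_of_carrier units_of_one)
  \<comment> \<open>The target of a unit is a unit; its inverse is the \<open>h\<close> of
    \<open>actor_peiffer\<close>.\<close>
  have "nt_tgt \<eta> \<in> Units (ggd_End G)"
    using Units_hom[OF nt_tgt_hom _ \<eta>(1)] by simp
  then show "nt_id G (nt_tgt \<eta>) \<otimes>\<^bsub>units_of (Nat_monoid G)\<^esub> \<zeta>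
      \<otimes>\<^bsub>units_of (Nat_monoid G)\<^esub> inv\<^bsub>units_of (Nat_monoid G)\<^esub> nt_id G (nt_tgt \<eta>)
      \<otimes>\<^bsub>units_of (Nat_monoid G)\<^esub> \<eta> = \<eta> \<otimes>\<^bsub>units_of (Nat_monoid G)\<^esub> \<zeta>"
    using \<eta> \<zeta> by (simp add: units_of_mult units_of_inv_nt_id actor_peiffer Nat.Units_closed)
qed simp_all

end

section \<open>The comparison isomorphism\<close>

context group_groupoid begin

abbreviation "Ker \<equiv> kernel (Mor G) (Obj G) (src G)"

lemma Ker_iff [simp]: "a \<in> Ker \<longleftrightarrow> a \<in> carrier (Mor G) \<and> src G a = \<one>\<^bsub>Obj G\<^esub>"
  by (simp add: kernel_def)

lemma xmod_of_ggd_simps [simp]: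
  "Top (xmod_of_ggd G) = (Mor G)\<lparr>carrier := Ker\<rparr>" "Base (xmod_of_ggd G) = Obj G"
  "bdry (xmod_of_ggd G) = tgt G"
  "xact (xmod_of_ggd G) x a = idn G x \<otimes>\<^bsub>Mor G\<^esub> a \<otimes>\<^bsub>Mor G\<^esub> inv\<^bsub>Mor G\<^esub> idn G x"
  by (simp_all add: xmod_of_ggd_def)

sublocale xm: crossed_module "xmod_of_ggd G" by (rule crossed_module_xmod)

section \<open>Restriction to the kernel: endomorphisms of \<open>G\<close> and of its crossed
  module\<close>

lemma lambda_simps [simp]:
  "snd (lambda_map G f) = snd f"
  "a \<in> Ker \<Longrightarrow> fst (lambda_map G f) a = fst f a"
  by (simp_all add: lambda_map_def split_beta)

lemma xmod_End_iff:
  "p \<in> carrier (xmod_End (xmod_of_ggd G)) \<longleftrightarrow>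
    fst p \<in> extensional Ker \<and> snd p \<in> extensional (carrier (Obj G)) \<and> snd p \<in> hom (Obj G) (Obj G) \<and>
    (\<forall>a \<in> Ker. fst p a \<in> Ker) \<and>
    (\<forall>a \<in> Ker. \<forall>b \<in> Ker. fst p (a \<otimes>\<^bsub>Mor G\<^esub> b) = fst p a \<otimes>\<^bsub>Mor G\<^esub> fst p b) \<and>
    (\<forall>a \<in> Ker. snd p (tgt G a) = tgt G (fst p a)) \<and>
    (\<forall>x \<in> carrier (Obj G). \<forall>a \<in> Ker. fst p (idn G x \<otimes>\<^bsub>Mor G\<^esub> a \<otimes>\<^bsub>Mor G\<^esub> inv\<^bsub>Mor G\<^esub> idn G x)
      = idn G (snd p x) \<otimes>\<^bsub>Mor G\<^esub> fst p a \<otimes>\<^bsub>Mor G\<^esub> inv\<^bsub>Mor G\<^esub> idn G (snd p x))"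
  by (auto simp: xmod_End_def xmod_hom_def split_beta mem_Times_iff hom_def Pi_iff simp del: Ker_iff)

lemma lambda_closed: "f \<in> carrier (ggd_End G) \<Longrightarrow> lambda_map G f \<in> carrier (xmod_End (xmod_of_ggd G))"
  unfolding xmod_End_iff
  by (auto simp: lambda_map_def split_beta End_extensional intro!: homI)

text \<open>Surjectivity of \<open>lambda_map G\<close>. Since \<open>a = (a - 1_x) + 1_x\<close>
  with \<open>x\<close> the source of \<open>a\<close> and the first summand in \<open>Ker\<close>,
  the formula is the only possible extension of \<open>p\<close>. It is exported because the target
  of a transformation built from a derivation is computed from it.\<close>

lemma xmod_End_lift:
  assumes p: "p \<in> carrier (xmod_End (xmod_of_ggd G))"
  obtains f where "f \<in> carrier (ggd_End G)" "lambda_map G f = p"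
    and "\<And>a. a \<in> carrier (Mor G) \<Longrightarrow>
      fst f a = fst p (a \<otimes>\<^bsub>Mor G\<^esub> inv\<^bsub>Mor G\<^esub> idn G (src G a)) \<otimes>\<^bsub>Mor G\<^esub> idn G (snd p (src G a))"
proof
  let ?k = "\<lambda>a. a \<otimes>\<^bsub>Mor G\<^esub> inv\<^bsub>Mor G\<^esub> idn G (src G a)"
  define f where "f = (\<lambda>a \<in> carrier (Mor G). fst p (?k a) \<otimes>\<^bsub>Mor G\<^esub> idn G (snd p (src G a)), snd p)"
  note P = p[unfolded xmod_End_iff]
  interpret p0: group_hom "Obj G" "Obj G" "snd p" by unfold_locales (use P in blast)
  have k: "?k a \<in> Ker" if "a \<in> carrier (Mor G)" for a
    using that by simp
  have pK: "fst p a \<in> carrier (Mor G)" "src G (fst p a) = \<one>\<^bsub>Obj G\<^esub>" "tgt G (fst p a) = snd p (tgt G a)"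
    if "a \<in> Ker" for a
    using P that by (metis Ker_iff)+
  \<comment> \<open>Needed for identities: the kernel part \<open>?k (idn G x)\<close> is
    neutral.\<close>
  have p1: "fst p \<one>\<^bsub>Mor G\<^esub> = \<one>\<^bsub>Mor G\<^esub>"
  proof -
    have "fst p (\<one>\<^bsub>Mor G\<^esub> \<otimes>\<^bsub>Mor G\<^esub> \<one>\<^bsub>Mor G\<^esub>) = fst p \<one>\<^bsub>Mor G\<^esub> \<otimes>\<^bsub>Mor G\<^esub> fst p \<one>\<^bsub>Mor G\<^esub>"
      using P by (metis Ker_iff mor.one_closed src.hom_one)
    then show ?thesis
      using pK(1)[of "\<one>\<^bsub>Mor G\<^esub>"] by (simp add: mor.l_cancel_one')
  qed
  have mult: "fst p (?k (a \<otimes>\<^bsub>Mor G\<^esub> b)) \<otimes>\<^bsub>Mor G\<^esub> idn G (snd p (src G (a \<otimes>\<^bsub>Mor G\<^esub> b)))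
    = (fst p (?k a) \<otimes>\<^bsub>Mor G\<^esub> idn G (snd p (src G a))) \<otimes>\<^bsub>Mor G\<^esub> (fst p (?k b) \<otimes>\<^bsub>Mor G\<^esub> idn G (snd p (src G b)))"
    if a: "a \<in> carrier (Mor G)" "b \<in> carrier (Mor G)" for a b
  proof -
    let ?i = "idn G (src G a)"
    have c: "?i \<otimes>\<^bsub>Mor G\<^esub> ?k b \<otimes>\<^bsub>Mor G\<^esub> inv\<^bsub>Mor G\<^esub> ?i \<in> Ker"
      using a by simp
    \<comment> \<open>The kernel part of a sum is that of \<open>a\<close> plus the action of the
      source of \<open>a\<close> on that of \<open>b\<close>. So additivity of the extension uses
      that \<open>p\<close> respects the action.\<close>
    have "?k (a \<otimes>\<^bsub>Mor G\<^esub> b) = ?k a \<otimes>\<^bsub>Mor G\<^esub> (?i \<otimes>\<^bsub>Mor G\<^esub> ?k b \<otimes>\<^bsub>Mor G\<^esub> inv\<^bsub>Mor G\<^esub> ?i)"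
      using a by (simp add: mor.group_simps)
    then have "fst p (?k (a \<otimes>\<^bsub>Mor G\<^esub> b))
      = fst p (?k a) \<otimes>\<^bsub>Mor G\<^esub> fst p (?i \<otimes>\<^bsub>Mor G\<^esub> ?k b \<otimes>\<^bsub>Mor G\<^esub> inv\<^bsub>Mor G\<^esub> ?i)"
      using P k[OF a(1)] c by metis
    also have "fst p (?i \<otimes>\<^bsub>Mor G\<^esub> ?k b \<otimes>\<^bsub>Mor G\<^esub> inv\<^bsub>Mor G\<^esub> ?i)
      = idn G (snd p (src G a)) \<otimes>\<^bsub>Mor G\<^esub> fst p (?k b) \<otimes>\<^bsub>Mor G\<^esub> inv\<^bsub>Mor G\<^esub> idn G (snd p (src G a))"
      using P k[OF a(2)] src.hom_closed[OF a(1)] by blast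
    finally show ?thesis
      using a pK(1)[OF k] by (simp add: mor.group_simps)
  qed
  show "f \<in> carrier (ggd_End G)"
    unfolding End_iff
  proof (intro conjI ballI)
    show "fst f \<in> hom (Mor G) (Mor G)"
      using pK[OF k] mult by (intro homI) (simp_all add: f_def)
    show "snd f \<in> extensional (carrier (Obj G))"
      using P by (simp add: f_def)
    fix a assume a: "a \<in> carrier (Mor G)"
    show "src G (fst f a) = snd f (src G a)" "tgt G (fst f a) = snd f (tgt G a)"
      using a pK[OF k[OF a]] by (simp_all add: f_def obj.m_assoc)
  qed (simp_all add: f_def p1)
  show "lambda_map G f = p"
  proof (rule prod_eqI)
    show "fst (lambda_map G f) = fst p"
    proof (rule extensionalityI)
      show "fst (lambda_map G f) \<in> extensional Ker" by (simp add: lambda_map_def split_beta)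
      show "fst p \<in> extensional Ker" using P by blast
      show "fst (lambda_map G f) a = fst p a" if "a \<in> Ker" for a
        using that pK(1)[OF that] by (simp add: f_def)
    qed
  qed (simp add: f_def)
  show "fst f a = fst p (?k a) \<otimes>\<^bsub>Mor G\<^esub> idn G (snd p (src G a))" if "a \<in> carrier (Mor G)" for a
    using that by (simp add: f_def)
qed

text \<open>The same splitting \<open>a = (a - 1_x) + 1_x\<close>: the value on the first summand is
  seen by the restriction to \<open>Ker\<close>, the value on the second by the object part.\<close>

lemma lambda_inj: "inj_on (lambda_map G) (carrier (ggd_End G))"
proof (rule inj_onI)
  fix f g
  assume f: "f \<in> carrier (ggd_End G)" and g: "g \<in> carrier (ggd_End G)"
    and eq: "lambda_map G f = lambda_map G g"
  have snd: "snd f = snd g"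
    using arg_cong[OF eq, of snd] by simp
  show "f = g"
  proof (rule End_eqI[OF f g])
    fix a assume a: "a \<in> carrier (Mor G)"
    let ?k = "a \<otimes>\<^bsub>Mor G\<^esub> inv\<^bsub>Mor G\<^esub> idn G (src G a)"
    have "fst (lambda_map G f) ?k = fst (lambda_map G g) ?k"
      by (simp only: eq)
    then have "fst f ?k = fst g ?k"
      using a by simp
    then show "fst f a = fst g a"
      using f g a by (simp add: snd)
  qed (simp add: snd)
qed

lemma lambda_iso: "monoid_iso (ggd_End G) (xmod_End (xmod_of_ggd G)) (lambda_map G)"
proof (rule monoid_isoI)
  show "lambda_map G \<in> hom (ggd_End G) (xmod_End (xmod_of_ggd G))"
  proof (rule homI)
    fix f g assume fg: "f \<in> carrier (ggd_End G)" "g \<in> carrier (ggd_End G)"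
    have "fst (lambda_map G (f \<otimes>\<^bsub>ggd_End G\<^esub> g)) = compose Ker (fst (lambda_map G f)) (fst (lambda_map G g))"
      by (rule extensionalityI[of _ Ker]) (use fg in \<open>auto simp: lambda_map_def split_beta compose_def\<close>)
    moreover have "snd (lambda_map G (f \<otimes>\<^bsub>ggd_End G\<^esub> g)) = compose (carrier (Obj G)) (snd (lambda_map G f)) (snd (lambda_map G g))"
      by (simp add: ggd_End_def split_beta)
    ultimately show "lambda_map G (f \<otimes>\<^bsub>ggd_End G\<^esub> g) = lambda_map G f \<otimes>\<^bsub>xmod_End (xmod_of_ggd G)\<^esub> lambda_map G g"
      by (intro prod_eqI) (simp_all add: xmod_End_def split_beta)
  qed (rule lambda_closed)
  show "lambda_map G \<one>\<^bsub>ggd_End G\<^esub> = \<one>\<^bsub>xmod_End (xmod_of_ggd G)\<^esub>"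
    by (auto simp: lambda_map_def ggd_End_def xmod_End_def)
  show "\<exists>f \<in> carrier (ggd_End G). lambda_map G f = p" if "p \<in> carrier (xmod_End (xmod_of_ggd G))" for p
    using xmod_End_lift[OF that] by metis
qed (rule lambda_inj)

section \<open>Transformations out of the identity and derivations\<close>

text \<open>All transformations out of the identity, invertible or not. The units of this monoid
  form the top group of the crossed module of the actor.\<close>

abbreviation "Nat0 \<equiv> (Nat_monoid G)\<lparr>carrier := kernel (Nat_monoid G) (ggd_End G) nt_src\<rparr>"

lemma Nat0_iff [simp]: "\<eta> \<in> kernel (Nat_monoid G) (ggd_End G) nt_src \<longleftrightarrow> \<eta> \<in> nat_trans G \<and> nt_src \<eta> = \<one>\<^bsub>ggd_End G\<^esub>"
  by (simp add: kernel_def)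

lemma xi_simp [simp]:
  "x \<in> carrier (Obj G) \<Longrightarrow> xi_map G \<eta> x = nt_map \<eta> x \<otimes>\<^bsub>Mor G\<^esub> inv\<^bsub>Mor G\<^esub> idn G x"
  by (simp add: xi_map_def)

lemma derivations_iff:
  "d \<in> derivations (xmod_of_ggd G) \<longleftrightarrow>
    d \<in> extensional (carrier (Obj G)) \<and> (\<forall>x \<in> carrier (Obj G). d x \<in> Ker) \<and>
    (\<forall>x \<in> carrier (Obj G). \<forall>y \<in> carrier (Obj G). d (x \<otimes>\<^bsub>Obj G\<^esub> y) =
      d x \<otimes>\<^bsub>Mor G\<^esub> (idn G x \<otimes>\<^bsub>Mor G\<^esub> d y \<otimes>\<^bsub>Mor G\<^esub> inv\<^bsub>Mor G\<^esub> idn G x))"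
  by (auto simp: derivations_def PiE_iff simp del: Ker_iff)

text \<open>Since \<open>1_{x+y} = 1_x + 1_y\<close>, the difference
  \<open>\<eta>(x+y) - 1_{x+y}\<close> equals
  \<open>(\<eta>(x) - 1_x) + (1_x + (\<eta>(y) - 1_y) - 1_x)\<close>, which is the derivation
  rule.\<close>

lemma xi_derivation:
  assumes "\<eta> \<in> carrier Nat0"
  shows "xi_map G \<eta> \<in> derivations (xmod_of_ggd G)"
  unfolding derivations_iff using assms
  by (auto simp: mor.group_simps) (simp add: xi_map_def)

lemma sigma_xi:
  assumes "\<eta> \<in> carrier Nat0"
  shows "der_sigma (xmod_of_ggd G) (xi_map G \<eta>) = snd (nt_tgt \<eta>)"
proof (rule extensionalityI)
  show "der_sigma (xmod_of_ggd G) (xi_map G \<eta>) \<in> extensional (carrier (Obj G))"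
    by (simp add: der_sigma_def)
  show "snd (nt_tgt \<eta>) \<in> extensional (carrier (Obj G))"
    using assms by (intro End_extensional) simp
  show "der_sigma (xmod_of_ggd G) (xi_map G \<eta>) x = snd (nt_tgt \<eta>) x" if "x \<in> carrier (Obj G)" for x
    using assms that by (simp add: der_sigma_def obj.m_assoc)
qed

text \<open>Compatibility with the boundaries. For \<open>a\<close> in \<open>Ker\<close> with
  target \<open>y\<close>, and \<open>g\<close> the target of \<open>\<eta>\<close>, naturality
  gives \<open>g(a) = \<eta>(y) \<circ> a = (\<eta>(y) - 1_y) + a\<close>, the value of
  \<open>der_theta\<close>.\<close>

lemma lambda_nt_tgt:
  assumes "\<eta> \<in> carrier Nat0"
  shows "lambda_map G (nt_tgt \<eta>) =
    (der_theta (xmod_of_ggd G) (xi_map G \<eta>), der_sigma (xmod_of_ggd G) (xi_map G \<eta>))"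
proof (rule prod_eqI)
  show "fst (lambda_map G (nt_tgt \<eta>)) =
    fst (der_theta (xmod_of_ggd G) (xi_map G \<eta>), der_sigma (xmod_of_ggd G) (xi_map G \<eta>))"
  proof (rule extensionalityI)
    show "fst (lambda_map G (nt_tgt \<eta>)) \<in> extensional Ker"
      by (simp add: lambda_map_def split_beta)
    show "fst (der_theta (xmod_of_ggd G) (xi_map G \<eta>), der_sigma (xmod_of_ggd G) (xi_map G \<eta>)) \<in> extensional Ker"
      by (simp add: der_theta_def)
    fix a assume a: "a \<in> Ker"
    \<comment> \<open>\<open>\<eta>\<close> at the zero object is the zero morphism, which is the
      identity there; inserting it creates one side of the naturality square.\<close>
    then have "fst (nt_tgt \<eta>) a = cmp G (fst (nt_tgt \<eta>) a) (nt_map \<eta> (src G a))"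
      using assms cmp_idn(2)[of "fst (nt_tgt \<eta>) a" "\<one>\<^bsub>Obj G\<^esub>"] by simp
    also have "\<dots> = cmp G (nt_map \<eta> (tgt G a)) a"
      using assms a by (subst naturality[symmetric]) simp_all
    also have "\<dots> = nt_map \<eta> (tgt G a) \<otimes>\<^bsub>Mor G\<^esub> inv\<^bsub>Mor G\<^esub> idn G (tgt G a) \<otimes>\<^bsub>Mor G\<^esub> a"
      using assms a by (simp add: cmp_eq mor.m_assoc)
    finally show "fst (lambda_map G (nt_tgt \<eta>)) a =
      fst (der_theta (xmod_of_ggd G) (xi_map G \<eta>), der_sigma (xmod_of_ggd G) (xi_map G \<eta>)) a"
      using a by (simp add: der_theta_def)
  qed
qed (simp add: sigma_xi[OF assms])

text \<open>The components are recovered by cancelling \<open>1_x\<close>. The target of the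
  transformation is recovered from the derivation through \<open>lambda_nt_tgt\<close> and the
  injectivity of \<open>lambda_map G\<close>.\<close>

lemma xi_inj: "inj_on (xi_map G) (carrier Nat0)"
proof (rule inj_onI)
  fix \<eta> \<zeta>
  assume \<eta>: "\<eta> \<in> carrier Nat0" and \<zeta>: "\<zeta> \<in> carrier Nat0" and eq: "xi_map G \<eta> = xi_map G \<zeta>"
  show "\<eta> = \<zeta>"
  proof (rule nat_trans_eqI)
    show "nt_tgt \<eta> = nt_tgt \<zeta>"
    proof (rule inj_onD[OF lambda_inj])
      show "lambda_map G (nt_tgt \<eta>) = lambda_map G (nt_tgt \<zeta>)"
        by (simp only: lambda_nt_tgt[OF \<eta>] lambda_nt_tgt[OF \<zeta>] eq)
    qed (use \<eta> \<zeta> in simp_all)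
    fix x assume x: "x \<in> carrier (Obj G)"
    then show "nt_map \<eta> x = nt_map \<zeta> x"
      using fun_cong[OF eq, of x] \<eta> \<zeta> by simp
  qed (use \<eta> \<zeta> in simp_all)
qed

text \<open>The preimage has components \<open>d(x) + 1_x\<close>; its target is the endomorphism
  \<open>g\<close> lifting the pair \<open>der_theta\<close>, \<open>der_sigma\<close> of
  \<open>d\<close>.\<close>

lemma xi_surj:
  assumes d: "d \<in> derivations (xmod_of_ggd G)"
  shows "\<exists>\<eta> \<in> carrier Nat0. xi_map G \<eta> = d"
proof -
  let ?s = "der_sigma (xmod_of_ggd G) d"
  note D = d[unfolded derivations_iff]
  have dc [simp]: "d x \<in> carrier (Mor G)" "src G (d x) = \<one>\<^bsub>Obj G\<^esub>" if "x \<in> carrier (Obj G)" for x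
    using D that by (metis Ker_iff)+
  have dm: "d (x \<otimes>\<^bsub>Obj G\<^esub> y) = d x \<otimes>\<^bsub>Mor G\<^esub> (idn G x \<otimes>\<^bsub>Mor G\<^esub> d y \<otimes>\<^bsub>Mor G\<^esub> inv\<^bsub>Mor G\<^esub> idn G x)"
    if "x \<in> carrier (Obj G)" "y \<in> carrier (Obj G)" for x y
    using D that by blast
  have sigma: "?s x = tgt G (d x) \<otimes>\<^bsub>Obj G\<^esub> x" if "x \<in> carrier (Obj G)" for x
    using that by (simp add: der_sigma_def)
  obtain g where g: "g \<in> carrier (ggd_End G)"
    and lambda_g: "lambda_map G g = (der_theta (xmod_of_ggd G) d, ?s)"
    and fst_g: "\<And>a. a \<in> carrier (Mor G) \<Longrightarrow>
      fst g a = der_theta (xmod_of_ggd G) d (a \<otimes>\<^bsub>Mor G\<^esub> inv\<^bsub>Mor G\<^esub> idn G (src G a)) \<otimes>\<^bsub>Mor G\<^esub> idn G (?s (src G a))"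
    using xmod_End_lift[OF xm.der_theta_sigma_End[OF d]] by (metis fst_conv snd_conv)
  have snd_g: "snd g x = tgt G (d x) \<otimes>\<^bsub>Obj G\<^esub> x" if "x \<in> carrier (Obj G)" for x
    using arg_cong[OF lambda_g, of snd] sigma[OF that] by simp
  define \<eta> where "\<eta> = \<lparr>nt_src = \<one>\<^bsub>ggd_End G\<^esub>, nt_tgt = g,
    nt_map = (\<lambda>x \<in> carrier (Obj G). d x \<otimes>\<^bsub>Mor G\<^esub> idn G x)\<rparr>"
  \<comment> \<open>With \<open>k = a - 1_x\<close>, the target of \<open>a\<close> is
    \<open>tgt k + x\<close>. The derivation rule expands \<open>d\<close> there, and Peiffer
    replaces the action of \<open>tgt k\<close> by conjugation by \<open>k\<close>. Both sides
    become \<open>d(tgt k) + k + d(x) + 1_x\<close>.\<close>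
  have natural: "cmp G (d (tgt G a) \<otimes>\<^bsub>Mor G\<^esub> idn G (tgt G a)) a
    = cmp G (fst g a) (d (src G a) \<otimes>\<^bsub>Mor G\<^esub> idn G (src G a))"
    if a: "a \<in> carrier (Mor G)" for a
  proof -
    let ?x = "src G a" and ?y = "tgt G a"
    let ?k = "a \<otimes>\<^bsub>Mor G\<^esub> inv\<^bsub>Mor G\<^esub> idn G ?x"
    have k: "?k \<in> carrier (Mor G)" "src G ?k = \<one>\<^bsub>Obj G\<^esub>" "?k \<in> Ker"
      using a by simp_all
    have y: "?y = tgt G ?k \<otimes>\<^bsub>Obj G\<^esub> ?x"
      using a by (simp add: obj.m_assoc)
    \<comment> \<open>The rule \<open>tgt.hom_mult\<close> is deleted here and in later steps on
      \<open>?k\<close>, so that \<open>tgt G ?k\<close> stays one term.\<close>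
    have pf: "idn G (tgt G ?k) \<otimes>\<^bsub>Mor G\<^esub> d ?x \<otimes>\<^bsub>Mor G\<^esub> inv\<^bsub>Mor G\<^esub> idn G (tgt G ?k)
      = ?k \<otimes>\<^bsub>Mor G\<^esub> d ?x \<otimes>\<^bsub>Mor G\<^esub> inv\<^bsub>Mor G\<^esub> ?k"
      using xm.peiffer[of ?k "d ?x"] k a
      by (simp add: mor.m_inv_consistent[OF src.subgroup_kernel] del: src.hom_mult tgt.hom_mult)
    have dy: "d ?y = d (tgt G ?k) \<otimes>\<^bsub>Mor G\<^esub> (?k \<otimes>\<^bsub>Mor G\<^esub> d ?x \<otimes>\<^bsub>Mor G\<^esub> inv\<^bsub>Mor G\<^esub> ?k)"
      using k a by (subst y, subst dm) (simp_all only: pf tgt.hom_closed src.hom_closed)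
    have "cmp G (d ?y \<otimes>\<^bsub>Mor G\<^esub> idn G ?y) a = d ?y \<otimes>\<^bsub>Mor G\<^esub> a"
      using a by (simp add: cmp_eq mor.group_simps)
    also have "\<dots> = d (tgt G ?k) \<otimes>\<^bsub>Mor G\<^esub> (?k \<otimes>\<^bsub>Mor G\<^esub> d ?x \<otimes>\<^bsub>Mor G\<^esub> inv\<^bsub>Mor G\<^esub> ?k) \<otimes>\<^bsub>Mor G\<^esub> a"
      by (simp only: dy)
    also have "\<dots> = d (tgt G ?k) \<otimes>\<^bsub>Mor G\<^esub> ?k \<otimes>\<^bsub>Mor G\<^esub> (d ?x \<otimes>\<^bsub>Mor G\<^esub> idn G ?x)"
      using a by (simp add: mor.group_simps del: tgt.hom_mult)
    also have "\<dots> = cmp G (fst g a) (d ?x \<otimes>\<^bsub>Mor G\<^esub> idn G ?x)"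
    proof -
      have g_eq: "fst g a = d (tgt G ?k) \<otimes>\<^bsub>Mor G\<^esub> ?k \<otimes>\<^bsub>Mor G\<^esub> idn G (?s ?x)"
        using fst_g[OF a] k by (simp add: der_theta_def del: tgt.hom_mult)
      have s: "src G (fst g a) = ?s ?x" "?s ?x \<in> carrier (Obj G)"
        using g a by (simp_all add: snd_g sigma)
      have "cmp G (fst g a) (d ?x \<otimes>\<^bsub>Mor G\<^esub> idn G ?x)
        = fst g a \<otimes>\<^bsub>Mor G\<^esub> (inv\<^bsub>Mor G\<^esub> idn G (?s ?x) \<otimes>\<^bsub>Mor G\<^esub> (d ?x \<otimes>\<^bsub>Mor G\<^esub> idn G ?x))"
        using g a s cmp_eq[of "fst g a" "d ?x \<otimes>\<^bsub>Mor G\<^esub> idn G ?x"] by (simp add: sigma)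
      then show ?thesis
        using a s by (simp add: g_eq mor.group_simps del: tgt.hom_mult)
    qed
    finally show ?thesis .
  qed
  have "\<eta> \<in> nat_trans G"
    unfolding nat_trans_def mem_Collect_eq
    using g natural by (auto simp: \<eta>_def snd_g dm mor.group_simps intro!: homI)
  moreover have "xi_map G \<eta> = d"
  proof (rule extensionalityI)
    show "xi_map G \<eta> \<in> extensional (carrier (Obj G))" by (simp add: xi_map_def)
    show "d \<in> extensional (carrier (Obj G))" using D by blast
    show "xi_map G \<eta> x = d x" if "x \<in> carrier (Obj G)" for x
      using that by (simp add: \<eta>_def mor.group_simps)
  qed
  moreover have "nt_src \<eta> = \<one>\<^bsub>ggd_End G\<^esub>"
    by (simp add: \<eta>_def)
  ultimately show ?thesis
    by auto
qed

text \<open>With \<open>g\<close> the target of \<open>\<zeta>\<close>, the horizontal composite at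
  \<open>x\<close> is \<open>\<eta>(g(x)) \<circ> \<zeta>(x) = \<eta>(g(x)) - 1_{g(x)} +
  \<zeta>(x)\<close>. Subtracting \<open>1_x\<close> gives the product of derivations, because
  \<open>g\<close> is \<open>der_sigma\<close> of the derivation of \<open>\<zeta>\<close> by
  \<open>sigma_xi\<close>.\<close>

lemma xi_iso: "monoid_iso Nat0 (Der_monoid (xmod_of_ggd G)) (xi_map G)"
proof (rule monoid_isoI)
  show "xi_map G \<in> hom Nat0 (Der_monoid (xmod_of_ggd G))"
  proof (rule homI)
    fix \<eta> assume \<eta>: "\<eta> \<in> carrier Nat0"
    then show "xi_map G \<eta> \<in> carrier (Der_monoid (xmod_of_ggd G))"
      using xi_derivation by (simp add: Der_monoid_def)
    fix \<zeta> assume \<zeta>: "\<zeta> \<in> carrier Nat0"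
    have "xi_map G (nt_hcomp G \<eta> \<zeta>) x = xi_map G \<eta> (snd (nt_tgt \<zeta>) x) \<otimes>\<^bsub>Mor G\<^esub> xi_map G \<zeta> x"
      if "x \<in> carrier (Obj G)" for x
      using \<eta> \<zeta> that by (simp add: cmp_eq mor.group_simps)
    then have "xi_map G (nt_hcomp G \<eta> \<zeta>) =
      (\<lambda>x \<in> carrier (Obj G). xi_map G \<eta> (snd (nt_tgt \<zeta>) x) \<otimes>\<^bsub>Mor G\<^esub> xi_map G \<zeta> x)"
      by (intro extensionalityI[of _ "carrier (Obj G)"]) (simp_all add: xi_map_def)
    then show "xi_map G (\<eta> \<otimes>\<^bsub>Nat0\<^esub> \<zeta>)
      = xi_map G \<eta> \<otimes>\<^bsub>Der_monoid (xmod_of_ggd G)\<^esub> xi_map G \<zeta>"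
      using sigma_xi[OF \<zeta>] by (simp add: Der_monoid_def)
  qed
  show "xi_map G \<one>\<^bsub>Nat0\<^esub> = \<one>\<^bsub>Der_monoid (xmod_of_ggd G)\<^esub>"
    by (rule extensionalityI[of _ "carrier (Obj G)"]) (simp_all add: xi_map_def Der_monoid_def)
  show "\<exists>\<eta> \<in> carrier Nat0. xi_map G \<eta> = d" if "d \<in> carrier (Der_monoid (xmod_of_ggd G))" for d
    using xi_surj that by (simp add: Der_monoid_def)
qed (rule xi_inj)

section \<open>Compatibility with the actions, and passage to units\<close>

text \<open>The conjugated transformation has components \<open>f(\<eta>(f^{-1}(x)))\<close>, and
  \<open>f\<close> sends the identity at \<open>f^{-1}(x)\<close> to \<open>1_x\<close>; so its
  derivation is \<open>f d f^{-1}\<close>.\<close>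

lemma xi_act:
  assumes f: "f \<in> Units (ggd_End G)" and \<eta>: "\<eta> \<in> carrier Nat0"
  shows "xact (actor_xmod (xmod_of_ggd G)) (lambda_map G f) (xi_map G \<eta>)
    = xi_map G (nt_hcomp G (nt_hcomp G (nt_id G f) \<eta>) (nt_id G (inv\<^bsub>ggd_End G\<^esub> f)))"
proof -
  let ?h = "inv\<^bsub>ggd_End G\<^esub> f"
  have fc: "f \<in> carrier (ggd_End G)" "?h \<in> carrier (ggd_End G)"
    using f by auto
  have hf: "snd ?h (snd f x) = x" and fh: "snd f (snd ?h x) = x" if x: "x \<in> carrier (Obj G)" for x
    using End_compose(2)[OF x, of ?h f] End_compose(2)[OF x, of f ?h] f x by simp_all
  have inj: "inj_on (snd f) (carrier (Obj G))"
    by (rule inj_on_inverseI[of _ "snd ?h"]) (rule hf)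
  \<comment> \<open>The inverse function in the definition of the actor's action agrees on objects
    with the object part of the inverse in the endomorphism monoid.\<close>
  have inv: "inv_into (carrier (Obj G)) (snd f) x = snd ?h x" if "x \<in> carrier (Obj G)" for x
    by (rule inv_into_f_eq[OF inj]) (use that fc fh in simp_all)
  have eq: "fst (lambda_map G f) (xi_map G \<eta> (inv_into (carrier (Obj G)) (snd f) x))
    = xi_map G (nt_hcomp G (nt_hcomp G (nt_id G f) \<eta>) (nt_id G ?h)) x"
    if x: "x \<in> carrier (Obj G)" for x
    using \<eta> x fc by (simp add: inv nt_id_conj fh del: nt_hcomp_simps)
  have "xact (actor_xmod (xmod_of_ggd G)) (lambda_map G f) (xi_map G \<eta>)
    = (\<lambda>x \<in> carrier (Obj G). fst (lambda_map G f) (xi_map G \<eta> (inv_into (carrier (Obj G)) (snd f) x)))"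
    by (simp add: actor_xmod_def split_beta)
  also have "\<dots> = xi_map G (nt_hcomp G (nt_hcomp G (nt_id G f) \<eta>) (nt_id G ?h))"
    by (rule extensionalityI[of _ "carrier (Obj G)"]) (simp_all only: restrict_extensional restrict_apply' eq, simp add: xi_map_def)
  finally show ?thesis .
qed

end

theorem theorem3p13:
  fixes G :: "('m, 'o) ggd"
  assumes "group_groupoid G"
  shows "crossed_module (xmod_of_ggd (actor_ggd G)) \<and>
         crossed_module (actor_xmod (xmod_of_ggd G)) \<and>
         (xi_map G, lambda_map G)
           \<in> xmod_iso (xmod_of_ggd (actor_ggd G)) (actor_xmod (xmod_of_ggd G))"
proof -
  interpret group_groupoid G by fact
  let ?A = "xmod_of_ggd (actor_ggd G)" and ?Y = "actor_xmod (xmod_of_ggd G)"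
  have monoid_Nat0: "monoid Nat0"
    by (intro submonoid_hom_kernel monoid_Nat monoid_End nt_src_hom) simp
  \<comment> \<open>The top group arises as the kernel inside the group of units; as the units of
    the kernel monoid it is accessible to \<open>xi_iso\<close>.\<close>
  have Top: "Top ?A = units_of Nat0"
    using units_of_hom_kernel[OF monoid_Nat monoid_End nt_src_hom] by (simp add: xmod_of_ggd_def)
  have Base: "Base ?A = units_of (ggd_End G)" and bdry: "bdry ?A = nt_tgt"
    by (simp_all add: xmod_of_ggd_def)
  have act: "xact ?A f \<eta> = nt_hcomp G (nt_hcomp G (nt_id G f) \<eta>) (nt_id G (inv\<^bsub>ggd_End G\<^esub> f))"
    if "f \<in> Units (ggd_End G)" for f \<eta>
    using that by (simp add: xmod_of_ggd_def units_of_mult units_of_inv_nt_id)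
  have Y: "Top ?Y = units_of (Der_monoid (xmod_of_ggd G))" "Base ?Y = units_of (xmod_End (xmod_of_ggd G))"
    "bdry ?Y d = (der_theta (xmod_of_ggd G) d, der_sigma (xmod_of_ggd G) d)" for d
    by (simp_all add: actor_xmod_def xmod_Aut_def)
  have Units_Nat0: "\<eta> \<in> carrier Nat0" if "\<eta> \<in> Units Nat0" for \<eta>
    using that monoid.Units_closed[OF monoid_Nat0] by blast
  have "crossed_module ?Y \<and> (xi_map G, lambda_map G) \<in> xmod_iso ?A ?Y"
  proof (rule xmod_iso_transport[OF crossed_module_actor_ggd], unfold Top Base bdry Y units_of_carrier)
    show "group (units_of (Der_monoid (xmod_of_ggd G)))"
      by (rule monoid.units_group[OF monoid_iso_imp_monoid[OF monoid_Nat0 xi_iso]])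
    show "group (units_of (xmod_End (xmod_of_ggd G)))"
      by (rule monoid.units_group[OF monoid_iso_imp_monoid[OF monoid_End lambda_iso]])
    show "xi_map G \<in> iso (units_of Nat0) (units_of (Der_monoid (xmod_of_ggd G)))"
      by (rule monoid_iso_units_of[OF xi_iso monoid_Nat0])
    show "lambda_map G \<in> iso (units_of (ggd_End G)) (units_of (xmod_End (xmod_of_ggd G)))"
      by (rule monoid_iso_units_of[OF lambda_iso monoid_End])
    show "(der_theta (xmod_of_ggd G) (xi_map G \<eta>), der_sigma (xmod_of_ggd G) (xi_map G \<eta>))
      = lambda_map G (nt_tgt \<eta>)" if "\<eta> \<in> Units Nat0" for \<eta>
      by (rule lambda_nt_tgt[OF Units_Nat0[OF that], symmetric])
    show "xact ?Y (lambda_map G f) (xi_map G \<eta>) = xi_map G (xact ?A f \<eta>)"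
      if "f \<in> Units (ggd_End G)" "\<eta> \<in> Units Nat0" for f \<eta>
      unfolding act[OF that(1)] by (rule xi_act[OF that(1) Units_Nat0[OF that(2)]])
  qed
  then show ?thesis
    using crossed_module_actor_ggd by simp
qed

end
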